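(* Let $G=\langle S\rangle=\langle s_1,\dots,s_k\rangle$ be a finite group, $k\ge1$, and let $\mathcal{Z}=\mathcal{Z}_i\cup\mathcal{Z}_r\cup\mathcal{Z}_b$ be the constructed cycle double cover of $D_{G,S}$ (which induces a polyhedral map). Then ${}^{G}\mathcal{Z}={}^{\mathrm{Aut}(D_{G,S})}\mathcal{Z}=\mathcal{Z}$, i.e. $\mathcal{Z}$ is invariant under the action of the automorphism group of the graph $D_{G,S}$.
   Context: Notation: $[k]=\{1,\dots,k\}$. $G$ is a finite group, $S=\{s_1,\dots,s_k\}$ is a generating set with $k\ge1$ (distinct) elements in the fixed ordering $s_1<\dots<s_k$. For $d\in[k]$ put $d^+=d+1$ if $d<k$ and $k^+=1$. A cycle of an undirected graph is a connected 2-regular subgraph. A cycle double cover (CDC) is a set of cycles such that every edge lies in exactly two of them. A CDC of a cubic graph induces a polyhedral map if any two distinct cycles of it have at most one edge in common. For a group $H$ acting on $D_{G,S}$ by automorphisms, ${}^{H}\mathcal{Z}:=\{\pi(z)\mid z\in\mathcal{Z},\ \pi\in H\}$. The group $G$ acts on $D_{G,S}$ by letting $x\in G$ act as $a_g^{d.i}\mapsto a_{xg}^{d.i}$, $c_g^{d.i}\mapsto c_{xg}^{d.i}$, $\mathfrak{C}_{[d,g,h]}(v)\mapsto\mathfrak{C}_{[d,xg,xh]}(v)$ (notation below). The Cayley graph $\mathrm{Cay}_{G,S}$ is the edge-coloured directed graph with vertex set $G$ and a directed edge $(g,gs_d)$ of colour $d$ for all $g\in G$, $d\in[k]$. $d$-chain: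 for an edge $(g,h)$ of colour $d$ (so $h=gs_d$), $\mathfrak{C}_{[d,g,h]}$ is the graph with $2d+10$ vertices labelled $u_1,\dots,u_d,\ell_1,\dots,\ell_d,0,1,\dots,9$ (the vertex with label $v$ is written $\mathfrak{C}_{[d,g,h]}(v)$) and edges (written via labels): $\{u_i,u_{i+1}\}$ and $\{\ell_i,\ell_{i+1}\}$ for $1\le i<d$; $\{u_i,\ell_i\}$ for $1\le i\le d$; $\{u_d,4\}$, $\{\ell_d,7\}$; and $\{0,1\},\{0,2\},\{0,3\},\{1,3\},\{1,6\},\{2,4\},\{2,5\},\{3,5\},\{4,7\},\{5,8\},\{6,9\},\{7,8\},\{8,9\}$. Blow-up graph $A_g$ of $g\in G$: - If $k\ge3$: vertices $a_g^{d.1},a_g^{d.2},a_g^{d.3},a_g^{d.4},c_g^{d.1},c_g^{d.2}$ for $d\in[k]$; edges, for each $d\in[k]$, $\{a_g^{d.1},a_g^{d.2}\}$, $\{a_g^{d.2},c_g^{d.1}\}$, $\{c_g^{d.1},a_g^{d.3}\}$, $\{a_g^{d.3},a_g^{d.4}\}$, $\{c_g^{d.1},c_g^{d.2}\}$, $\{c_g^{d.2},c_g^{d^+.2}\}$, $\{a_g^{d.4},a_g^{d^+.1}\}$. - If $k=2$: vertices $a_g^{d.1},\dots,a_g^{d.4},c_g^{d.1}$ for $d\in\{1,2\}$; edges $\{a_g^{d.1},a_g^{d.2}\}$, $\{a_g^{d.2},c_g^{d.1}\}$, $\{c_g^{d.1},a_g^{d.3}\}$, $\{a_g^{d.3},a_g^{d.4}\}$,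 $\{a_g^{d.4},a_g^{d^+.1}\}$ for $d\in\{1,2\}$, and $\{c_g^{1.1},c_g^{2.1}\}$. - If $k=1$: vertices $a_g^{1.1},\dots,a_g^{1.4}$; edges $\{a_g^{1.1},a_g^{1.2}\},\{a_g^{1.2},a_g^{1.3}\},\{a_g^{1.3},a_g^{1.4}\},\{a_g^{1.4},a_g^{1.1}\}$. The graph $D_{G,S}$ is the (cubic, undirected) graph obtained from the disjoint union of all $A_g$, $g\in G$, and all $\mathfrak{C}_{[d,g,h]}$, one for each $d\in[k]$ and each edge $(g,h)$ of colour $d$ of $\mathrm{Cay}_{G,S}$, by adding for each such edge the four edges $\{a_g^{d.1},\mathfrak{C}_{[d,g,h]}(u_1)\}$, $\{a_g^{d.2},\mathfrak{C}_{[d,g,h]}(\ell_1)\}$, $\{\mathfrak{C}_{[d,g,h]}(6),a_h^{d.4}\}$, $\{\mathfrak{C}_{[d,g,h]}(9),a_h^{d.3}\}$. Inner face cycles $\mathcal{Z}_i$ (each cycle is given by its cyclic vertex sequence): for every edge $(g,h)$ of colour $d$, with labels referring to $\mathfrak{C}_{[d,g,h]}$: $(u_i,u_{i+1},\ell_{i+1},\ell_i)$ for $1\le i<d$; $(u_d,4,7,\ell_d)$; $(0,1,3)$; $(0,2,5,3)$; $(2,4,7,8,5)$; $(1,3,5,8,9,6)$; $(a_g^{d.1},a_g^{d.2},\ell_1,u_1)$; $(6,9,a_h^{d.3},a_h^{d.4})$. Moreover for every $g\in G$: if $k\ge3$, the cycles $(c_g^{d.1},a_g^{d.3},a_g^{d.4},a_g^{d^+.1},a_g^{d^+.2},c_g^{d^+.1},c_g^{d^+.2},c_g^{d.2})$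 for $d\in[k]$ and $(c_g^{1.2},c_g^{2.2},\dots,c_g^{k.2})$; if $k=2$, the cycles $(c_g^{d.1},a_g^{d.3},a_g^{d.4},a_g^{d^+.1},a_g^{d^+.2},c_g^{d^+.1})$ for $d\in\{1,2\}$; if $k=1$, the cycle $(a_g^{1.1},a_g^{1.2},a_g^{1.3},a_g^{1.4})$. For an edge $(g,h)$ of colour $d$, the upper path from $a_g^{d.1}$ to $a_h^{d.4}$ is $a_g^{d.1},u_1,\dots,u_d,4,2,0,1,6,a_h^{d.4}$, and the lower path from $a_g^{d.2}$ to $a_h^{d.3}$ is $a_g^{d.2},\ell_1,\dots,\ell_d,7,8,9,a_h^{d.3}$ (labels in $\mathfrak{C}_{[d,g,h]}$). Roof edge cycles $\mathcal{Z}_r$: the roof edge cycle with starting point $g$ is traced as follows. Start at $a_g^{1.1}$ and take the upper path to $A_{gs_1}$; in general, having entered $A_h$ through the generator $s_d$ (i.e. at $a_h^{d.4}$), traverse the edge $\{a_h^{d.4},a_h^{d^+.1}\}$ and take the upper path from $a_h^{d^+.1}$ to $A_{hs_{d^+}}$; continue until a vertex is encountered for the second time. Let $H_{\mathrm{vis}}$ be the set of all $h\in G$ such that $A_h$ is entered via the last generator $s_k$. The set $\mathcal{Z}_r$ is obtained by setting $\tilde G:=G$, computing the roof edge cycle with starting point $1_G$, removing its set $H_{\mathrm{vis}}$ from $\tilde G$, and then repeating with any remaining element of $\tilde G$ as starting point until $\tilde G$ is empty; $\mathcal{Z}_r$ consists of all cycles computed. Base edge cycles $\mathcal{Z}_b$: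 for $d\in[k]$, the base edge cycle with starting point $g$ and generator $s_d$ starts at $a_g^{d.2}$ and takes the lower path to $a_{gs_d}^{d.3}$; in general, having arrived at $a_h^{d.3}$ it goes on to $c_h^{d.1}$, then $a_h^{d.2}$ (if $k=1$, directly from $a_h^{1.3}$ to $a_h^{1.2}$), and then takes the lower path to $a_{hs_d}^{d.3}$; continue until a vertex is encountered for the second time. Let $\bar H_{\mathrm{vis}}$ be the set of group elements $h$ visited. For each $d\in[k]$ set $\tilde G_d:=G$ and, as long as $\tilde G_d\neq\emptyset$, choose $g\in\tilde G_d$, compute the base edge cycle with starting point $g$ and generator $s_d$, and remove $\bar H_{\mathrm{vis}}$ from $\tilde G_d$; $\mathcal{Z}_b$ consists of all cycles computed for all $d\in[k]$. *)

theory Defs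
  imports "HOL-Algebra.Generated_Groups" "HOL-Algebra.Group_Action"
begin

section \<open>Undirected graphs and their automorphisms\<close>

record 'v ugraph =
  verts :: "'v set"
  edges :: "'v set set"

definition map_graph :: "('v \<Rightarrow> 'w) \<Rightarrow> 'v ugraph \<Rightarrow> 'w ugraph" where
  "map_graph f z = \<lparr>verts = f ` verts z, edges = (\<lambda>e. f ` e) ` edges z\<rparr>"

text \<open>The elements of \<open>Bij V\<close> are bijections \<open>V \<rightarrow> V\<close> that are extensional, so that an
  automorphism is determined by its values on the vertex set.\<close>

definition graph_aut :: "'v ugraph \<Rightarrow> ('v \<Rightarrow> 'v) set" where
  "graph_aut D = {\<pi> \<in> Bij (verts D).
     \<forall>u \<in> verts D. \<forall>v \<in> verts D. {u, v} \<in> edges D \<longleftrightarrow> {\<pi> u, \<pi> v} \<in> edges D}"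

definition aut_group :: "'v ugraph \<Rightarrow> ('v \<Rightarrow> 'v) monoid" where
  "aut_group D = BijGroup (verts D) \<lparr>carrier := graph_aut D\<rparr>"

text \<open>The set \<open>\<^sup>H\<Z>\<close> for a group \<open>H\<close> acting on vertices via \<open>\<phi>\<close>; the members of \<open>\<Z>\<close> are
  subgraphs.\<close>

definition translates :: "('h, 'm) monoid_scheme \<Rightarrow> ('h \<Rightarrow> 'v \<Rightarrow> 'v) \<Rightarrow> 'v ugraph set \<Rightarrow> 'v ugraph set" where
  "translates H \<phi> Z = {map_graph (\<phi> x) z | x z. x \<in> carrier H \<and> z \<in> Z}"

text \<open>A cycle, given by its cyclic vertex sequence, is regarded as a subgraph; in particular it
  does not depend on starting point or direction.\<close>

definition cycle_graph :: "'v list \<Rightarrow> 'v ugraph" where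
  "cycle_graph vs = \<lparr>verts = set vs,
     edges = {{vs ! i, vs ! (Suc i mod length vs)} | i. i < length vs}\<rparr>"


section \<open>The graph \<open>D\<^bsub>G,S\<^esub>\<close>\<close>

text \<open>The ordered set \<open>S = {s\<^sub>1 < \<dots> < s\<^sub>k}\<close> is given by \<open>k\<close> and a function \<open>s\<close> that is injective
  on \<open>{1..k}\<close>; values of \<open>s\<close> outside \<open>{1..k}\<close> are irrelevant.\<close>

datatype label = U nat | L nat | N nat  \<comment> \<open>\<open>u\<^sub>i\<close>, \<open>\<ell>\<^sub>i\<close> and the labels \<open>0, \<dots>, 9\<close>\<close>

text \<open>\<open>A g d i\<close> is \<open>a\<^sub>g\<close> with superscript \<open>d.i\<close>, \<open>C g d i\<close> is \<open>c\<^sub>g\<close> with superscript \<open>d.i\<close>, and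
  \<open>X d g h v\<close> is the vertex with label \<open>v\<close> of the \<open>d\<close>-chain of the edge \<open>(g, h)\<close>.\<close>

datatype 'g vertex = A 'g nat nat | C 'g nat nat | X nat 'g 'g label

definition nxt :: "nat \<Rightarrow> nat \<Rightarrow> nat" where
  "nxt k d = (if d < k then d + 1 else 1)"

definition cayley_edges :: "('g, 'm) monoid_scheme \<Rightarrow> nat \<Rightarrow> (nat \<Rightarrow> 'g) \<Rightarrow> (nat \<times> 'g \<times> 'g) set" where
  "cayley_edges G k s = {(d, g, h). d \<in> {1..k} \<and> g \<in> carrier G \<and> h = g \<otimes>\<^bsub>G\<^esub> s d}"

definition chain_labels :: "nat \<Rightarrow> label set" where
  "chain_labels d = U ` {1..d} \<union> L ` {1..d} \<union> N ` {0..9}"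

definition chain_label_edges :: "nat \<Rightarrow> label set set" where
  "chain_label_edges d =
     {{U i, U (i + 1)} | i. 1 \<le> i \<and> i < d} \<union>
     {{L i, L (i + 1)} | i. 1 \<le> i \<and> i < d} \<union>
     {{U i, L i} | i. 1 \<le> i \<and> i \<le> d} \<union>
     {{U d, N 4}, {L d, N 7}} \<union>
     {{N 0, N 1}, {N 0, N 2}, {N 0, N 3}, {N 1, N 3}, {N 1, N 6}, {N 2, N 4}, {N 2, N 5},
      {N 3, N 5}, {N 4, N 7}, {N 5, N 8}, {N 6, N 9}, {N 7, N 8}, {N 8, N 9}}"

definition chain :: "nat \<Rightarrow> 'g \<Rightarrow> 'g \<Rightarrow> 'g vertex ugraph" where
  "chain d g h = map_graph (X d g h) \<lparr>verts = chain_labels d, edges = chain_label_edges d\<rparr>"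

definition blow_up :: "nat \<Rightarrow> 'g \<Rightarrow> 'g vertex ugraph" where
  "blow_up k g =
    (if k \<ge> 3 then
       \<lparr>verts = (\<Union>d \<in> {1..k}. {A g d 1, A g d 2, A g d 3, A g d 4, C g d 1, C g d 2}),
        edges = (\<Union>d \<in> {1..k}.
          {{A g d 1, A g d 2}, {A g d 2, C g d 1}, {C g d 1, A g d 3}, {A g d 3, A g d 4},
           {C g d 1, C g d 2}, {C g d 2, C g (nxt k d) 2}, {A g d 4, A g (nxt k d) 1}})\<rparr>
     else if k = 2 then
       \<lparr>verts = (\<Union>d \<in> {1, 2}. {A g d 1, A g d 2, A g d 3, A g d 4, C g d 1}),
        edges = (\<Union>d \<in> {1, 2}.
          {{A g d 1, A g d 2}, {A g d 2, C g d 1}, {C g d 1, A g d 3}, {A g d 3, A g d 4},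
           {A g d 4, A g (nxt k d) 1}}) \<union> {{C g 1 1, C g 2 1}}\<rparr>
     else
       \<lparr>verts = {A g 1 1, A g 1 2, A g 1 3, A g 1 4},
        edges = {{A g 1 1, A g 1 2}, {A g 1 2, A g 1 3}, {A g 1 3, A g 1 4}, {A g 1 4, A g 1 1}}\<rparr>)"

definition D_graph :: "('g, 'm) monoid_scheme \<Rightarrow> nat \<Rightarrow> (nat \<Rightarrow> 'g) \<Rightarrow> 'g vertex ugraph" where
  "D_graph G k s =
     \<lparr>verts = (\<Union>g \<in> carrier G. verts (blow_up k g)) \<union>
              (\<Union>(d, g, h) \<in> cayley_edges G k s. verts (chain d g h)),
      edges = (\<Union>g \<in> carrier G. edges (blow_up k g)) \<union>
              (\<Union>(d, g, h) \<in> cayley_edges G k s. edges (chain d g h)) \<union>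
              (\<Union>(d, g, h) \<in> cayley_edges G k s.
                 {{A g d 1, X d g h (U 1)}, {A g d 2, X d g h (L 1)},
                  {X d g h (N 6), A h d 4}, {X d g h (N 9), A h d 3}})\<rparr>"

fun left_mult :: "('g, 'm) monoid_scheme \<Rightarrow> 'g \<Rightarrow> 'g vertex \<Rightarrow> 'g vertex" where
  "left_mult G x (A g d i) = A (x \<otimes>\<^bsub>G\<^esub> g) d i"
| "left_mult G x (C g d i) = C (x \<otimes>\<^bsub>G\<^esub> g) d i"
| "left_mult G x (X d g h v) = X d (x \<otimes>\<^bsub>G\<^esub> g) (x \<otimes>\<^bsub>G\<^esub> h) v"

definition D_action :: "('g, 'm) monoid_scheme \<Rightarrow> nat \<Rightarrow> (nat \<Rightarrow> 'g) \<Rightarrow> 'g \<Rightarrow> 'g vertex \<Rightarrow> 'g vertex" where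
  "D_action G k s x = restrict (left_mult G x) (verts (D_graph G k s))"


section \<open>The cycle double cover\<close>

definition inner_face_cycles :: "('g, 'm) monoid_scheme \<Rightarrow> nat \<Rightarrow> (nat \<Rightarrow> 'g) \<Rightarrow> 'g vertex ugraph set" where
  "inner_face_cycles G k s =
     (\<Union>(d, g, h) \<in> cayley_edges G k s.
        {cycle_graph (map (X d g h) [U i, U (i + 1), L (i + 1), L i]) | i. 1 \<le> i \<and> i < d} \<union>
        {cycle_graph (map (X d g h) [U d, N 4, N 7, L d]),
         cycle_graph (map (X d g h) [N 0, N 1, N 3]),
         cycle_graph (map (X d g h) [N 0, N 2, N 5, N 3]),
         cycle_graph (map (X d g h) [N 2, N 4, N 7, N 8, N 5]),
         cycle_graph (map (X d g h) [N 1, N 3, N 5, N 8, N 9, N 6]),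
         cycle_graph [A g d 1, A g d 2, X d g h (L 1), X d g h (U 1)],
         cycle_graph [X d g h (N 6), X d g h (N 9), A h d 3, A h d 4]}) \<union>
     (\<Union>g \<in> carrier G.
        if k \<ge> 3 then
          {cycle_graph [C g d 1, A g d 3, A g d 4, A g (nxt k d) 1, A g (nxt k d) 2,
                  C g (nxt k d) 1, C g (nxt k d) 2, C g d 2] | d. d \<in> {1..k}} \<union>
          {cycle_graph (map (\<lambda>d. C g d 2) [1..<k + 1])}
        else if k = 2 then
          {cycle_graph [C g d 1, A g d 3, A g d 4, A g (nxt k d) 1, A g (nxt k d) 2, C g (nxt k d) 1]
             | d. d \<in> {1, 2}}
        else
          {cycle_graph [A g 1 1, A g 1 2, A g 1 3, A g 1 4]})"

definition upper_path :: "('g, 'm) monoid_scheme \<Rightarrow> (nat \<Rightarrow> 'g) \<Rightarrow> 'g \<Rightarrow> nat \<Rightarrow> 'g vertex list" where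
  "upper_path G s g d = (let h = g \<otimes>\<^bsub>G\<^esub> s d in
     A g d 1 # map (X d g h) (map U [1..<d + 1] @ [N 4, N 2, N 0, N 1, N 6]) @ [A h d 4])"

definition lower_path :: "('g, 'm) monoid_scheme \<Rightarrow> (nat \<Rightarrow> 'g) \<Rightarrow> 'g \<Rightarrow> nat \<Rightarrow> 'g vertex list" where
  "lower_path G s g d = (let h = g \<otimes>\<^bsub>G\<^esub> s d in
     A g d 2 # map (X d g h) (map L [1..<d + 1] @ [N 7, N 8, N 9]) @ [A h d 3])"

text \<open>The infinite walk obtained by concatenating infinitely many (nonempty) segments: the
  first \<open>n + 1\<close> segments suffice to determine its vertex number \<open>n\<close>.\<close>

definition walk :: "(nat \<Rightarrow> 'v list) \<Rightarrow> nat \<Rightarrow> 'v" where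
  "walk p n = concat (map p [0..<n + 1]) ! n"

text \<open>Follow a walk until a vertex is encountered for the second time. On the walks below,
  which come from an injective successor map, the repeated vertex is the starting vertex, so
  the vertices traversed before the repetition form the cycle.\<close>

definition traced_cycle :: "(nat \<Rightarrow> 'v) \<Rightarrow> 'v ugraph" where
  "traced_cycle w = cycle_graph (map w [0..<(LEAST m. \<exists>j<m. w j = w m)])"

text \<open>The successive pairs \<open>(h, d)\<close> such that the upper path starting in \<open>A\<^sub>h\<close> along \<open>s\<^sub>d\<close> is taken.\<close>

fun roof_state :: "('g, 'm) monoid_scheme \<Rightarrow> nat \<Rightarrow> (nat \<Rightarrow> 'g) \<Rightarrow> 'g \<Rightarrow> nat \<Rightarrow> 'g \<times> nat" where
  "roof_state G k s g 0 = (g, 1)"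
| "roof_state G k s g (Suc n) = (case roof_state G k s g n of (h, d) \<Rightarrow> (h \<otimes>\<^bsub>G\<^esub> s d, nxt k d))"

definition roof_edge_cycle :: "('g, 'm) monoid_scheme \<Rightarrow> nat \<Rightarrow> (nat \<Rightarrow> 'g) \<Rightarrow> 'g \<Rightarrow> 'g vertex ugraph" where
  "roof_edge_cycle G k s g =
     traced_cycle (walk (\<lambda>n. case roof_state G k s g n of (h, d) \<Rightarrow> upper_path G s h d))"

definition base_segment :: "('g, 'm) monoid_scheme \<Rightarrow> nat \<Rightarrow> (nat \<Rightarrow> 'g) \<Rightarrow> 'g \<Rightarrow> nat \<Rightarrow> 'g vertex list" where
  "base_segment G k s g d =
     lower_path G s g d @ (if k = 1 then [] else [C (g \<otimes>\<^bsub>G\<^esub> s d) d 1])"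

definition base_edge_cycle :: "('g, 'm) monoid_scheme \<Rightarrow> nat \<Rightarrow> (nat \<Rightarrow> 'g) \<Rightarrow> nat \<Rightarrow> 'g \<Rightarrow> 'g vertex ugraph" where
  "base_edge_cycle G k s d g =
     traced_cycle (walk (\<lambda>n. base_segment G k s (g \<otimes>\<^bsub>G\<^esub> s d [^]\<^bsub>G\<^esub> n) d))"

definition roof_visited :: "('g, 'm) monoid_scheme \<Rightarrow> nat \<Rightarrow> 'g vertex ugraph \<Rightarrow> 'g set" where
  "roof_visited G k z = {h \<in> carrier G. A h k 4 \<in> verts z}"

definition base_visited :: "('g, 'm) monoid_scheme \<Rightarrow> nat \<Rightarrow> 'g vertex ugraph \<Rightarrow> 'g set" where
  "base_visited G k z = {h \<in> carrier G. verts z \<inter> verts (blow_up k h) \<noteq> {}}"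

text \<open>One round of the construction: a state consists of the set of group elements that are still
  available as starting points and the set of cycles computed so far.\<close>

definition greedy_round :: "('g \<Rightarrow> 'z) \<Rightarrow> ('z \<Rightarrow> 'g set) \<Rightarrow> 'g set \<times> 'z set \<Rightarrow> 'g set \<times> 'z set \<Rightarrow> bool" where
  "greedy_round cyc vis st st' \<longleftrightarrow>
     (\<exists>g \<in> fst st. st' = (fst st - vis (cyc g), insert (cyc g) (snd st)))"

text \<open>The construction involves choices of starting points; the following predicates describe all
  possible outcomes.\<close>

definition roof_edge_cycles :: "('g, 'm) monoid_scheme \<Rightarrow> nat \<Rightarrow> (nat \<Rightarrow> 'g) \<Rightarrow> 'g vertex ugraph set \<Rightarrow> bool" where
  "roof_edge_cycles G k s Zr \<longleftrightarrow>
     (let cyc = roof_edge_cycle G k s; vis = roof_visited G k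
      in (greedy_round cyc vis)\<^sup>*\<^sup>* (carrier G - vis (cyc \<one>\<^bsub>G\<^esub>), {cyc \<one>\<^bsub>G\<^esub>}) ({}, Zr))"

definition base_edge_cycles :: "('g, 'm) monoid_scheme \<Rightarrow> nat \<Rightarrow> (nat \<Rightarrow> 'g) \<Rightarrow> 'g vertex ugraph set \<Rightarrow> bool" where
  "base_edge_cycles G k s Zb \<longleftrightarrow>
     (\<exists>B. (\<forall>d \<in> {1..k}.
             (greedy_round (base_edge_cycle G k s d) (base_visited G k))\<^sup>*\<^sup>* (carrier G, {}) ({}, B d)) \<and>
          Zb = (\<Union>d \<in> {1..k}. B d))"

end

theory Submission
  imports Defs
begin

text \<open>Every automorphism \<open>\<pi>\<close> of \<open>D\<^bsub>G,S\<^esub>\<close> is a left multiplication. The labels 0, 1, 2, 3, 5 of a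
  chain span a triangle and a quadrangle with a common edge; this configuration occurs nowhere else,
  and its only possible nontrivial symmetry does not extend to the rest of the chain. So \<open>\<pi>\<close> maps
  chains to chains. Following the ladder at the lower end of a chain until it breaks off recovers the
  colour \<open>d\<close>, so there are maps \<open>\<phi>\<^sub>d\<close> on \<open>G\<close> such that \<open>\<pi>\<close> maps the \<open>d\<close>-chain starting in \<open>g\<close> to the
  one starting in \<open>\<phi>\<^sub>d g\<close>. The blow-up graphs force \<open>\<phi>\<^sub>d\<close> to be independent of \<open>d\<close> and to commute
  with right multiplication by generators, so it is a left multiplication. Conversely, the greedily
  computed cycles are all orbits of injective successor maps that commute with left multiplication.\<close>

section \<open>Traced walks\<close>

text \<open>All iterates are taken, so the length that \<open>traced_cycle\<close> extracts by
  \<open>LEAST\<close> is not mentioned; an image under a map commuting with \<open>f\<close> is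
  then again of this form.\<close>

definition orbit_graph :: "('v \<Rightarrow> 'v) \<Rightarrow> 'v \<Rightarrow> 'v ugraph" where
  "orbit_graph f x =
     \<lparr>verts = range (\<lambda>n. (f ^^ n) x), edges = range (\<lambda>n. {(f ^^ n) x, (f ^^ Suc n) x})\<rparr>"

text \<open>Steps inside a segment follow \<open>f\<close> by \<open>seg\<close>, and steps across a
  junction by \<open>link\<close>; so the whole concatenation follows \<open>f\<close>.\<close>

lemma walk_Suc:
  assumes ne: "\<And>n. p n \<noteq> []"
    and seg: "\<And>n. successively (\<lambda>x y. y = f x) (p n)"
    and link: "\<And>n. hd (p (Suc n)) = f (last (p n))"
  shows "walk p (Suc n) = f (walk p n)"
proof -
  define c where "c m = concat (map p [0..<m])" for m
  have c_Suc: "c (Suc m) = c m @ p m" for m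
    by (simp add: c_def)
  \<comment> \<open>Since no segment is empty, \<open>n + 2\<close> segments contain the positions
    \<open>n\<close> and \<open>n + 1\<close>, and position \<open>n\<close> already lies in the
    first \<open>n + 1\<close> of them.\<close>
  have len: "m \<le> length (c m)" for m
  proof (induction m)
    case (Suc m)
    then show ?case
      using ne[of m] by (cases "p m") (auto simp: c_Suc)
  qed simp
  have last: "last (c (Suc m)) = last (p m)" for m
    using ne[of m] by (simp add: c_Suc)
  have "successively (\<lambda>x y. y = f x) (c m)" for m
  proof (induction m)
    case (Suc m)
    have "c m = [] \<or> hd (p m) = f (last (c m))"
      using last link by (cases m) (simp_all add: c_def)
    then show ?case
      using Suc seg[of m] by (auto simp: c_Suc successively_append_iff)
  qed (simp add: c_def)
  then have "c (Suc (Suc n)) ! Suc n = f (c (Suc (Suc n)) ! n)"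
    using len[of "Suc (Suc n)"] by (simp add: successively_conv_nth)
  moreover have "c (Suc (Suc n)) ! n = c (Suc n) ! n"
    using len[of "Suc n"] by (subst c_Suc) (simp add: nth_append)
  ultimately show ?thesis
    by (simp add: walk_def c_def)
qed

lemma walk_eq_funpow:
  assumes "\<And>n. p n \<noteq> []"
    and "\<And>n. successively (\<lambda>x y. y = f x) (p n)"
    and "\<And>n. hd (p (Suc n)) = f (last (p n))"
  shows "walk p n = (f ^^ n) (hd (p 0))"
proof (induction n)
  case 0
  then show ?case
    using assms(1)[of 0] by (simp add: walk_def hd_conv_nth)
next
  case (Suc n)
  then show ?case
    using walk_Suc[of p f, OF assms] by simp
qed

section \<open>Orbits of an injective self-map of a finite set\<close>

locale finite_injection =
  fixes f :: "'v \<Rightarrow> 'v" and V :: "'v set"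
  assumes finite_V: "finite V" and closed: "\<And>v. v \<in> V \<Longrightarrow> f v \<in> V" and inj: "inj_on f V"
begin

lemma funpow_closed: "x \<in> V \<Longrightarrow> (f ^^ n) x \<in> V"
  by (induction n) (auto intro: closed)

text \<open>Pigeonhole yields a repetition, and injectivity makes the first one close up at the
  starting point.\<close>

lemma least_repetition:
  assumes "x \<in> V"
  defines "m \<equiv> LEAST m. \<exists>j<m. (f ^^ j) x = (f ^^ m) x"
  shows "m > 0" and "(f ^^ m) x = x"
proof -
  have "\<not> inj (\<lambda>n. (f ^^ n) x)"
    using finite_V funpow_closed[OF assms(1)]
    by (metis finite_imageD finite_subset image_subset_iff infinite_UNIV_nat)
  then obtain i j where "i < j" "(f ^^ i) x = (f ^^ j) x"
    by (metis (mono_tags, lifting) injI linorder_neqE_nat)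
  then have "\<exists>m. \<exists>j<m. (f ^^ j) x = (f ^^ m) x"
    by auto
  from LeastI_ex[OF this] have "\<exists>j<m. (f ^^ j) x = (f ^^ m) x"
    unfolding m_def .
  then obtain j where j: "j < m" "(f ^^ j) x = (f ^^ m) x"
    by blast
  then show "m > 0" by simp
  \<comment> \<open>Otherwise one application of \<open>f\<close> could be cancelled on both sides,
    giving a repetition before \<open>m\<close>.\<close>
  have "j = 0"
  proof (rule ccontr)
    assume "j \<noteq> 0"
    then obtain j' m' where jm: "j = Suc j'" "m = Suc m'"
      using j(1) by (cases j; cases m) auto
    then have "(f ^^ j') x = (f ^^ m') x"
      using j inj funpow_closed[OF assms(1)] by (auto dest: inj_onD)
    then show False
      using not_less_Least[of m' "\<lambda>m. \<exists>j<m. (f ^^ j) x = (f ^^ m) x"] j(1) jm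
      unfolding m_def by auto
  qed
  then show "(f ^^ m) x = x"
    using j by simp
qed

text \<open>By periodicity all indices may be reduced modulo \<open>m\<close>, so the first
  \<open>m\<close> iterates, with the closing edge, give the whole orbit.\<close>

lemma traced_cycle_eq_orbit_graph:
  assumes "x \<in> V"
  shows "traced_cycle (\<lambda>n. (f ^^ n) x) = orbit_graph f x"
proof -
  define m where "m = (LEAST m. \<exists>j<m. (f ^^ j) x = (f ^^ m) x)"
  define w where "w n = (f ^^ n) x" for n
  have m: "m > 0" "(f ^^ m) x = x"
    unfolding m_def using least_repetition[OF assms] by auto
  then have w_mod: "w (n mod m) = w n" for n
    unfolding w_def by (simp add: funpow_mod_eq)
  have "range w = w ` {..<m}"
    using m(1) w_mod by (metis (no_types, lifting) equalityI image_subset_iff lessThan_iff mod_less_divisor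
        rangeI subsetI image_eqI)
  moreover have "{{map w [0..<m] ! i, map w [0..<m] ! (Suc i mod m)} |i. i < m}
      = range (\<lambda>n. {w n, w (Suc n)})" (is "?l = ?r")
  proof -
    have nth: "{map w [0..<m] ! i, map w [0..<m] ! (Suc i mod m)} = {w i, w (Suc i)}" if "i < m" for i
      using that m(1) w_mod[of "Suc i"] by simp
    have wrap: "{w n, w (Suc n)} = {w (n mod m), w (Suc (n mod m))}" for n
      using w_mod[of n] w_mod[of "Suc n"] w_mod[of "Suc (n mod m)"] by (simp add: mod_Suc_eq)
    show ?thesis
    proof (intro equalityI subsetI)
      fix e assume "e \<in> ?l"
      then obtain i where "i < m" "e = {map w [0..<m] ! i, map w [0..<m] ! (Suc i mod m)}"
        by auto
      then show "e \<in> ?r" unfolding nth[OF \<open>i < m\<close>] by simp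
    next
      fix e assume "e \<in> ?r"
      then obtain n where e: "e = {w (n mod m), w (Suc (n mod m))}"
        using wrap by auto
      have "n mod m < m" using m(1) by simp
      then show "e \<in> ?l" unfolding e nth[OF \<open>n mod m < m\<close>, symmetric] by blast
    qed
  qed
  ultimately have "cycle_graph (map w [0..<m]) = orbit_graph f x"
    unfolding cycle_graph_def orbit_graph_def w_def
    by (simp add: atLeast0LessThan)
  then show ?thesis
    unfolding traced_cycle_def m_def w_def .
qed

lemma orbit_graph_eqI:
  assumes "x \<in> V" and "y \<in> verts (orbit_graph f x)"
  shows "orbit_graph f y = orbit_graph f x"
proof -
  obtain m where m: "m > 0" "(f ^^ m) x = x"
    by (rule that[OF least_repetition[OF assms(1)]])
  obtain j where j: "y = (f ^^ j) x"
    using assms(2) by (auto simp: orbit_graph_def)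
  have shift: "(f ^^ n) y = (f ^^ (n + j)) x" for n
    by (simp add: j funpow_add)
  \<comment> \<open>If \<open>y\<close> lies \<open>j\<close> steps after \<open>x\<close>, then
    \<open>j * m - j\<close> further steps complete \<open>j\<close> full rounds and return to
    \<open>x\<close>; the subtraction is exact since \<open>m > 0\<close>.\<close>
  have unshift: "(f ^^ n) x = (f ^^ (n + j * m - j)) y" "(f ^^ Suc n) x = (f ^^ Suc (n + j * m - j)) y" for n
  proof -
    have e: "n + j * m - j + j = n + j * m" using m(1) by (simp add: trans_le_add2)
    have "(f ^^ (i + j * m)) x = (f ^^ i) x" for i
      using funpow_mod_eq[OF m(2), of "i + j * m"] funpow_mod_eq[OF m(2), of i] by simp
    from this[of n] this[of "Suc n"]
    show "(f ^^ n) x = (f ^^ (n + j * m - j)) y" "(f ^^ Suc n) x = (f ^^ Suc (n + j * m - j)) y"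
      using e by (simp_all only: shift add_Suc)
  qed
  have "range (\<lambda>n. (f ^^ n) y) = range (\<lambda>n. (f ^^ n) x)"
  proof (intro equalityI subsetI)
    fix v assume "v \<in> range (\<lambda>n. (f ^^ n) y)"
    then show "v \<in> range (\<lambda>n. (f ^^ n) x)" using shift by auto
  next
    fix v assume "v \<in> range (\<lambda>n. (f ^^ n) x)"
    then obtain n where "v = (f ^^ n) x" by auto
    then show "v \<in> range (\<lambda>n. (f ^^ n) y)" unfolding unshift(1)[of n] by simp
  qed
  moreover have "range (\<lambda>n. {(f ^^ n) y, (f ^^ Suc n) y}) = range (\<lambda>n. {(f ^^ n) x, (f ^^ Suc n) x})"
    (is "range ?a = range ?b")
  proof -
    have "?a n = ?b (n + j)" for n
      using shift[of n] shift[of "Suc n"] by simp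
    moreover have "?b n = ?a (n + j * m - j)" for n
      using unshift[of n] by simp
    ultimately show ?thesis by (metis (no_types, lifting) image_subset_iff rangeI subset_antisym)
  qed
  ultimately show ?thesis
    by (simp add: orbit_graph_def)
qed

lemma map_graph_orbit_graph:
  assumes "\<And>v. v \<in> V \<Longrightarrow> h (f v) = f (h v)" and "x \<in> V"
  shows "map_graph h (orbit_graph f x) = orbit_graph f (h x)"
proof -
  have "h ((f ^^ n) x) = (f ^^ n) (h x)" for n
    using assms funpow_closed by (induction n) auto
  from this this[of "Suc _"] show ?thesis
    by (simp add: map_graph_def orbit_graph_def image_image)
qed

lemma verts_orbit_graph_subset: "x \<in> V \<Longrightarrow> verts (orbit_graph f x) \<subseteq> V"
  by (auto simp: orbit_graph_def funpow_closed)

end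

lemma verts_orbit_graph_step:
  assumes "y \<in> verts (orbit_graph f x)" shows "f y \<in> verts (orbit_graph f x)"
proof -
  obtain n where "y = (f ^^ n) x" using assms by (auto simp: orbit_graph_def)
  then have "f y = (f ^^ Suc n) x" by simp
  then show ?thesis by (auto simp: orbit_graph_def simp del: funpow.simps)
qed

text \<open>Invariant: every element of \<open>M\<close> that is no longer available has its cycle
  among those computed. An element removed in a round is visited by the new cycle and hence
  generates the same one, so the choices do not matter. The initial state is general because the
  roof construction starts with one cycle already computed.\<close>

lemma greedy_round_result:
  assumes "(greedy_round cyc vis)\<^sup>*\<^sup>* (S, Z) ({}, Z')"
    and "\<And>g h. g \<in> M \<Longrightarrow> h \<in> M \<Longrightarrow> h \<in> vis (cyc g) \<Longrightarrow> cyc h = cyc g"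
    and "S \<subseteq> M" and "Z \<subseteq> cyc ` M" and "cyc ` (M - S) \<subseteq> Z"
  shows "Z' = cyc ` M"
proof -
  have "fst st \<subseteq> M \<and> snd st \<subseteq> cyc ` M \<and> cyc ` (M - fst st) \<subseteq> snd st"
    if "(greedy_round cyc vis)\<^sup>*\<^sup>* (S, Z) st" for st
    using that
  proof (induction rule: rtranclp_induct)
    case base
    then show ?case using assms by simp
  next
    case (step st st')
    then obtain g where g: "g \<in> fst st" "st' = (fst st - vis (cyc g), insert (cyc g) (snd st))"
      by (auto simp: greedy_round_def)
    have "cyc h \<in> snd st'" if h: "h \<in> M" "h \<notin> fst st'" for h
    proof (cases "h \<in> fst st")
      case True
      then have "cyc h = cyc g"
        using assms(2)[of g h] h g step.IH by auto
      then show ?thesis using g by simp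
    next
      case False
      then show ?thesis using h g step.IH by auto
    qed
    then show ?case using g step.IH by auto
  qed
  from this[OF assms(1)] show ?thesis by auto
qed

section \<open>Images of subgraphs under vertex maps\<close>

lemma map_graph_cycle_graph: "map_graph f (cycle_graph xs) = cycle_graph (map f xs)"
proof -
  have "(`) f ` {{xs ! i, xs ! (Suc i mod length xs)} |i. i < length xs}
     = {{map f xs ! i, map f xs ! (Suc i mod length xs)} |i. i < length xs}"
  proof -
    have "f ` {xs ! i, xs ! (Suc i mod length xs)} = {map f xs ! i, map f xs ! (Suc i mod length xs)}"
      if "i < length xs" for i
    proof -
      have "Suc i mod length xs < length xs" using that by (intro mod_less_divisor) auto
      then show ?thesis using that by simp
    qed
    then show ?thesis by (simp add: setcompr_eq_image image_image)
  qed
  then show ?thesis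
    by (simp add: map_graph_def cycle_graph_def)
qed

lemma map_graph_cong:
  assumes "\<And>v. v \<in> verts z \<Longrightarrow> f v = g v" and "\<Union> (edges z) \<subseteq> verts z"
  shows "map_graph f z = map_graph g z"
  unfolding map_graph_def using assms by (force intro!: image_cong)

lemma map_graph_id:
  assumes "\<And>v. v \<in> verts z \<Longrightarrow> f v = v" and "\<Union> (edges z) \<subseteq> verts z"
  shows "map_graph f z = z"
  using map_graph_cong[of z f id] assms by (simp add: map_graph_def)

lemma edges_cycle_graph: "\<Union> (edges (cycle_graph xs)) \<subseteq> verts (cycle_graph xs)"
proof -
  have "xs ! (Suc i mod length xs) \<in> set xs" if "i < length xs" for i
    using that by (intro nth_mem mod_less_divisor) auto
  then show ?thesis
    by (auto simp: cycle_graph_def)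
qed

lemma verts_cycle_graph [simp]: "verts (cycle_graph xs) = set xs"
  by (simp add: cycle_graph_def)

lemma edges_orbit_graph: "\<Union> (edges (orbit_graph f x)) \<subseteq> verts (orbit_graph f x)"
proof -
  have "(f ^^ n) x \<in> verts (orbit_graph f x)" for n
    by (simp add: orbit_graph_def)
  from this this[of "Suc _"] show ?thesis
    by (auto simp: orbit_graph_def)
qed

section \<open>Invariance under left multiplication\<close>

definition prv :: "nat \<Rightarrow> nat \<Rightarrow> nat" where
  "prv k d = (if 1 < d then d - 1 else k)"

lemma nxt_bounds [simp]: "Suc 0 \<le> nxt k d" "1 \<le> d \<Longrightarrow> d \<le> k \<Longrightarrow> nxt k d \<le> k"
  by (auto simp: nxt_def)

lemma prv_bounds [simp]:
  "1 \<le> d \<Longrightarrow> d \<le> k \<Longrightarrow> Suc 0 \<le> prv k d" "1 \<le> d \<Longrightarrow> d \<le> k \<Longrightarrow> prv k d \<le> k"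
  by (auto simp: prv_def)

lemma nxt_prv [simp]: "1 \<le> d \<Longrightarrow> d \<le> k \<Longrightarrow> nxt k (prv k d) = d"
  and prv_nxt [simp]: "1 \<le> d \<Longrightarrow> d \<le> k \<Longrightarrow> prv k (nxt k d) = d"
  by (auto simp: nxt_def prv_def)

lemma nxt_eq_iff:
  "1 \<le> d \<Longrightarrow> d \<le> k \<Longrightarrow> 1 \<le> e \<Longrightarrow> e \<le> k \<Longrightarrow> nxt k d = nxt k e \<longleftrightarrow> d = e"
  by (metis prv_nxt)

text \<open>The next vertex of a roof edge cycle depends on the current one alone, so tracing is
  iteration. The labels run through 4, 2, 0, 1, 6; the case \<open>i \<noteq> 1\<close> of
  \<open>A g d i\<close> is meant for \<open>i = 4\<close>, and vertices off the upper paths get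
  junk values.\<close>

fun roof_succ :: "('g, 'm) monoid_scheme \<Rightarrow> nat \<Rightarrow> (nat \<Rightarrow> 'g) \<Rightarrow> 'g vertex \<Rightarrow> 'g vertex" where
  "roof_succ G k s (A g d i) = (if i = 1 then X d g (g \<otimes>\<^bsub>G\<^esub> s d) (U 1) else A g (nxt k d) 1)"
| "roof_succ G k s (X d g h (U i)) = X d g h (if i < d then U (i + 1) else N 4)"
| "roof_succ G k s (X d g h (N i)) =
     (if i = 6 then A h d 4
      else X d g h (N (if i = 4 then 2 else if i = 2 then 0 else if i = 0 then 1 else 6)))"
| "roof_succ G k s v = v"

text \<open>The analogue along the labels 7, 8, 9. The case \<open>i \<noteq> 2\<close> is meant for
  \<open>A g d 3\<close>, from which \<open>A g d 2\<close> is reached directly if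
  \<open>k = 1\<close> and through \<open>C g d 1\<close> otherwise.\<close>

fun base_succ :: "('g, 'm) monoid_scheme \<Rightarrow> nat \<Rightarrow> (nat \<Rightarrow> 'g) \<Rightarrow> 'g vertex \<Rightarrow> 'g vertex" where
  "base_succ G k s (A g d i) =
     (if i = 2 then X d g (g \<otimes>\<^bsub>G\<^esub> s d) (L 1) else if k = 1 then A g d 2 else C g d 1)"
| "base_succ G k s (C g d i) = A g d 2"
| "base_succ G k s (X d g h (L i)) = X d g h (if i < d then L (i + 1) else N 7)"
| "base_succ G k s (X d g h (N i)) = (if i = 9 then A h d 3 else X d g h (N (i + 1)))"
| "base_succ G k s v = v"

lemma verts_D:
  "1 \<le> k \<Longrightarrow> A g d i \<in> verts (D_graph G k s) \<longleftrightarrow>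
     g \<in> carrier G \<and> 1 \<le> d \<and> d \<le> k \<and> i \<in> {1, 2, 3, 4}" (is "_ \<Longrightarrow> ?A")
  "1 \<le> k \<Longrightarrow> C g d i \<in> verts (D_graph G k s) \<longleftrightarrow>
     g \<in> carrier G \<and> 1 \<le> d \<and> d \<le> k \<and> (i = 1 \<and> 2 \<le> k \<or> i = 2 \<and> 3 \<le> k)" (is "_ \<Longrightarrow> ?C")
  "X d g h l \<in> verts (D_graph G k s) \<longleftrightarrow>
     g \<in> carrier G \<and> 1 \<le> d \<and> d \<le> k \<and> h = g \<otimes>\<^bsub>G\<^esub> s d \<and> l \<in> chain_labels d" (is ?X)
proof -
  show ?A ?C if "1 \<le> k"
  proof -
    have "k = 1 \<or> k = 2 \<or> k \<ge> 3" using that by linarith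
    then show ?A ?C
      by (elim disjE; fastforce simp: D_graph_def blow_up_def chain_def map_graph_def)+
  qed
  show ?X
    by (auto simp: D_graph_def blow_up_def chain_def map_graph_def cayley_edges_def split: if_splits)
qed

lemma chain_labels_iff [simp]:
  "U i \<in> chain_labels d \<longleftrightarrow> 1 \<le> i \<and> i \<le> d"
  "L i \<in> chain_labels d \<longleftrightarrow> 1 \<le> i \<and> i \<le> d"
  "N i \<in> chain_labels d \<longleftrightarrow> i \<le> 9"
  by (auto simp: chain_labels_def)

locale cayley_cover = group G for G (structure) +
  fixes k :: nat and s :: "nat \<Rightarrow> 'a"
  assumes finite_carrier: "finite (carrier G)" and k_pos: "1 \<le> k"
    and gen_closed: "s ` {1..k} \<subseteq> carrier G"
    and generates: "generate G (s ` {1..k}) = carrier G"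
begin

abbreviation D :: "'a vertex ugraph" where "D \<equiv> D_graph G k s"

text \<open>Colour and start of a Cayley edge determine its end, so \<open>d\<close> and
  \<open>g\<close> name a chain of \<open>D\<close>.\<close>

abbreviation Y :: "nat \<Rightarrow> 'a \<Rightarrow> label \<Rightarrow> 'a vertex" where
  "Y d g \<equiv> X d g (g \<otimes> s d)"

lemma s_closed: "1 \<le> d \<Longrightarrow> d \<le> k \<Longrightarrow> s d \<in> carrier G"
  using gen_closed by auto

lemma finite_verts_D: "finite (verts D)"
proof -
  have "finite (chain_labels d)" for d
    by (simp add: chain_labels_def)
  moreover have "cayley_edges G k s \<subseteq> (\<lambda>(d, g). (d, g, g \<otimes> s d)) ` ({1..k} \<times> carrier G)"
    by (auto simp: cayley_edges_def)
  then have "finite (cayley_edges G k s)"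
    by (rule finite_subset) (simp add: finite_carrier)
  ultimately show ?thesis
    by (auto simp: D_graph_def blow_up_def chain_def map_graph_def finite_carrier)
qed

text \<open>A finite invariant set on which the successor map is injective; its junk values destroy
  injectivity on \<open>verts D\<close>.\<close>

definition roof_verts :: "'a vertex set" where
  "roof_verts = {v \<in> verts D. \<exists>d g. (\<exists>i\<in>{1, 4}. v = A g d i) \<or> (\<exists>i. v = Y d g (U i)) \<or>
     (\<exists>i\<in>{4, 2, 0, 1, 6}. v = Y d g (N i))}"

definition base_verts :: "'a vertex set" where
  "base_verts = {v \<in> verts D. \<exists>d g. (\<exists>i\<in>{2, 3}. v = A g d i) \<or> v = C g d 1 \<or>
     (\<exists>i. v = Y d g (L i)) \<or> (\<exists>i\<in>{7, 8, 9}. v = Y d g (N i))}"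

lemma mult_gen_cancel [simp]:
  "1 \<le> d \<Longrightarrow> d \<le> k \<Longrightarrow> g \<in> carrier G \<Longrightarrow> h \<in> carrier G \<Longrightarrow> g \<otimes> s d = h \<otimes> s d \<longleftrightarrow> g = h"
  using s_closed by simp

text \<open>Only at a chain exit \<open>A h d 4\<close> is the predecessor found by computing in the
  group, by cancelling \<open>s d\<close>; at \<open>A g d 1\<close> it is unique because
  \<open>nxt k\<close> is injective on \<open>{1..k}\<close>.\<close>

sublocale roof: finite_injection "roof_succ G k s" roof_verts
proof
  show "finite roof_verts"
    by (rule finite_subset[OF _ finite_verts_D]) (auto simp: roof_verts_def)
  show "roof_succ G k s v \<in> roof_verts" if "v \<in> roof_verts" for v
    using that s_closed k_pos by (auto simp: roof_verts_def verts_D)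
  show "inj_on (roof_succ G k s) roof_verts"
    using k_pos by (intro inj_onI) (auto simp: roof_verts_def verts_D nxt_eq_iff split: if_splits)
qed

sublocale base: finite_injection "base_succ G k s" base_verts
proof
  show "finite base_verts"
    by (rule finite_subset[OF _ finite_verts_D]) (auto simp: base_verts_def)
  show "base_succ G k s v \<in> base_verts" if "v \<in> base_verts" for v
    using that s_closed k_pos by (auto simp: base_verts_def verts_D)
  show "inj_on (base_succ G k s) base_verts"
    using k_pos by (intro inj_onI) (auto simp: base_verts_def verts_D split: if_splits)
qed

section \<open>Traced cycles as orbits, independent of the choices\<close>

lemma successively_upper_path:
  assumes "1 \<le> d"
  shows "successively (\<lambda>x y. y = roof_succ G k s x) (upper_path G s g d)"
proof -
  have "successively (\<lambda>x y. y = roof_succ G k s x) (map (X d g h \<circ> U) [1..<d + 1])" for h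
    by (auto simp: successively_conv_nth simp del: upt_Suc)
  moreover have "[1..<d + 1] \<noteq> []" using assms by simp
  ultimately show ?thesis using assms
    by (auto simp: upper_path_def Let_def successively_append_iff successively_Cons hd_map last_map
        hd_append simp del: upt_Suc)
qed

lemma successively_base_segment:
  assumes "1 \<le> d"
  shows "successively (\<lambda>x y. y = base_succ G k s x) (base_segment G k s g d)"
proof -
  have "successively (\<lambda>x y. y = base_succ G k s x) (map (X d g h \<circ> L) [1..<d + 1])" for h
    by (auto simp: successively_conv_nth simp del: upt_Suc)
  moreover have "[1..<d + 1] \<noteq> []" using assms by simp
  ultimately show ?thesis using assms
    by (auto simp: base_segment_def lower_path_def Let_def successively_append_iff successively_Cons
        hd_map last_map hd_append simp del: upt_Suc)
qed

lemma roof_state_bounds: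
  "g \<in> carrier G \<Longrightarrow> roof_state G k s g n \<in> carrier G \<times> {1..k}"
proof (induction n)
  case (Suc n)
  then show ?case using s_closed by (cases "roof_state G k s g n") auto
qed (use k_pos in auto)

text \<open>Upper paths follow \<open>roof_succ\<close>, and the last vertex \<open>A h d 4\<close>
  of one is sent to the first vertex of the next.\<close>

lemma roof_edge_cycle_eq:
  assumes "g \<in> carrier G"
  shows "roof_edge_cycle G k s g = orbit_graph (roof_succ G k s) (A g 1 1)"
proof -
  let ?p = "\<lambda>n. case roof_state G k s g n of (h, d) \<Rightarrow> upper_path G s h d"
  have "walk ?p n = (roof_succ G k s ^^ n) (hd (?p 0))" for n
  proof (rule walk_eq_funpow)
    fix n
    obtain h d where hd: "roof_state G k s g n = (h, d)" "h \<in> carrier G" "1 \<le> d" "d \<le> k"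
      using roof_state_bounds[OF assms, of n] by (cases "roof_state G k s g n") auto
    show "?p n \<noteq> []" by (simp add: hd upper_path_def Let_def)
    show "successively (\<lambda>x y. y = roof_succ G k s x) (?p n)"
      using successively_upper_path hd by simp
    show "hd (?p (Suc n)) = roof_succ G k s (last (?p n))"
      by (simp add: hd upper_path_def Let_def)
  qed
  moreover have "hd (?p 0) = A g 1 1" by (simp add: upper_path_def Let_def)
  ultimately have "walk ?p = (\<lambda>n. (roof_succ G k s ^^ n) (A g 1 1))" by (simp add: fun_eq_iff)
  moreover have "A g 1 1 \<in> roof_verts"
    using assms k_pos by (auto simp: roof_verts_def verts_D)
  ultimately show ?thesis
    unfolding roof_edge_cycle_def using roof.traced_cycle_eq_orbit_graph by simp
qed

lemma base_edge_cycle_eq: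
  assumes "g \<in> carrier G" "1 \<le> d" "d \<le> k"
  shows "base_edge_cycle G k s d g = orbit_graph (base_succ G k s) (A g d 2)"
proof -
  let ?p = "\<lambda>n :: nat. base_segment G k s (g \<otimes> s d [^] n) d"
  have "walk ?p n = (base_succ G k s ^^ n) (hd (?p 0))" for n
  proof (rule walk_eq_funpow)
    fix n :: nat
    show "?p n \<noteq> []" by (simp add: base_segment_def lower_path_def Let_def)
    show "successively (\<lambda>x y. y = base_succ G k s x) (?p n)"
      using successively_base_segment assms by simp
    show "hd (?p (Suc n)) = base_succ G k s (last (?p n))"
      using assms s_closed by (simp add: base_segment_def lower_path_def Let_def m_assoc)
  qed
  moreover have "hd (?p 0) = A g d 2" using assms by (simp add: base_segment_def lower_path_def Let_def)
  ultimately have "walk ?p = (\<lambda>n. (base_succ G k s ^^ n) (A g d 2))" by (simp add: fun_eq_iff)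
  moreover have "A g d 2 \<in> base_verts"
    using assms by (auto simp: base_verts_def verts_D)
  ultimately show ?thesis
    unfolding base_edge_cycle_def using base.traced_cycle_eq_orbit_graph by simp
qed

lemma roof_edge_cycles_eq:
  assumes "roof_edge_cycles G k s Zr"
  shows "Zr = roof_edge_cycle G k s ` carrier G"
proof (rule greedy_round_result)
  let ?cyc = "roof_edge_cycle G k s" and ?vis = "roof_visited G k"
  show "(greedy_round ?cyc ?vis)\<^sup>*\<^sup>* (carrier G - ?vis (?cyc \<one>), {?cyc \<one>}) ({}, Zr)"
    using assms by (simp add: roof_edge_cycles_def Let_def)
  show vis: "?cyc h = ?cyc g" if "g \<in> carrier G" "h \<in> carrier G" "h \<in> ?vis (?cyc g)" for g h
  proof -
    have "A h k 4 \<in> verts (orbit_graph (roof_succ G k s) (A g 1 1))"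
      using that by (simp add: roof_visited_def roof_edge_cycle_eq)
    \<comment> \<open>As \<open>nxt k k = 1\<close>, one step after entering through the last
      generator the walk is at \<open>A h 1 1\<close>, the starting vertex of the cycle of
      \<open>h\<close>.\<close>
    from verts_orbit_graph_step[OF this]
    have "A h 1 1 \<in> verts (orbit_graph (roof_succ G k s) (A g 1 1))"
      by (simp add: nxt_def)
    moreover have "A g 1 1 \<in> roof_verts"
      using that k_pos by (auto simp: roof_verts_def verts_D)
    ultimately show ?thesis
      using that roof.orbit_graph_eqI by (simp add: roof_edge_cycle_eq)
  qed
  show "?cyc ` (carrier G - (carrier G - ?vis (?cyc \<one>))) \<subseteq> {?cyc \<one>}"
    using vis[of \<one>] by auto
qed auto

lemma base_edge_cycles_eq:
  assumes "base_edge_cycles G k s Zb"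
  shows "Zb = (\<Union>d\<in>{1..k}. base_edge_cycle G k s d ` carrier G)"
proof -
  obtain B where B: "Zb = (\<Union>d \<in> {1..k}. B d)"
    "\<And>d. d \<in> {1..k} \<Longrightarrow>
       (greedy_round (base_edge_cycle G k s d) (base_visited G k))\<^sup>*\<^sup>* (carrier G, {}) ({}, B d)"
    using assms unfolding base_edge_cycles_def by blast
  have "B d = base_edge_cycle G k s d ` carrier G" if d: "d \<in> {1..k}" for d
  proof (rule greedy_round_result[OF B(2)[OF d]])
    fix g h
    assume gh: "g \<in> carrier G" "h \<in> carrier G" "h \<in> base_visited G k (base_edge_cycle G k s d g)"
    let ?O = "verts (orbit_graph (base_succ G k s) (A g d 2))"
    have mem: "A g d 2 \<in> base_verts"
      using gh d by (auto simp: base_verts_def verts_D)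
    obtain v where v: "v \<in> ?O" "v \<in> verts (blow_up k h)"
      using gh d by (auto simp: base_visited_def base_edge_cycle_eq)
    \<comment> \<open>A visit only means meeting some vertex of the blow-up graph of
      \<open>h\<close>; since \<open>base_succ\<close> preserves the colour, that vertex has colour
      \<open>d\<close>.\<close>
    have same_d: "v \<in> ?O \<Longrightarrow> (case v of A _ e _ \<Rightarrow> e | C _ e _ \<Rightarrow> e | X e _ _ _ \<Rightarrow> e) = d" for v
    proof -
      have "(case (base_succ G k s ^^ n) (A g d 2) of A _ e _ \<Rightarrow> e | C _ e _ \<Rightarrow> e | X e _ _ _ \<Rightarrow> e) = d" for n
      proof (induction n)
        case (Suc n)
        have "(case base_succ G k s v of A _ e _ \<Rightarrow> e | C _ e _ \<Rightarrow> e | X e _ _ _ \<Rightarrow> e) =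
              (case v of A _ e _ \<Rightarrow> e | C _ e _ \<Rightarrow> e | X e _ _ _ \<Rightarrow> e)" for v :: "'a vertex"
          by (cases "(G, k, s, v)" rule: base_succ.cases) auto
        with Suc show ?case by simp
      qed simp
      then show "v \<in> ?O \<Longrightarrow> (case v of A _ e _ \<Rightarrow> e | C _ e _ \<Rightarrow> e | X e _ _ _ \<Rightarrow> e) = d"
        by (auto simp: orbit_graph_def)
    qed
    have "v \<in> base_verts" using v base.verts_orbit_graph_subset[OF mem] by auto
    then have "v = A h d 2 \<or> v = A h d 3 \<or> 2 \<le> k \<and> v = C h d 1"
      using v(2) same_d[OF v(1)] by (auto simp: base_verts_def verts_D blow_up_def split: if_splits)
    \<comment> \<open>From each of the three vertices at most two steps lead to
      \<open>A h d 2\<close>, where the cycle of \<open>h\<close> starts.\<close>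
    then have "A h d 2 \<in> ?O"
      using v(1) verts_orbit_graph_step[of "A h d 3"] verts_orbit_graph_step[of "C h d 1"] k_pos
      by (cases "k = 1") fastforce+
    then show "base_edge_cycle G k s d h = base_edge_cycle G k s d g"
      using gh d base.orbit_graph_eqI[OF mem] by (simp add: base_edge_cycle_eq)
  qed auto
  then show ?thesis using B(1) by simp
qed

section \<open>Equivariance of the cover\<close>

lemma left_mult_roof_succ:
  assumes "x \<in> carrier G" "v \<in> roof_verts"
  shows "left_mult G x (roof_succ G k s v) = roof_succ G k s (left_mult G x v)"
  using assms s_closed k_pos by (auto simp: roof_verts_def verts_D m_assoc)

lemma left_mult_base_succ:
  assumes "x \<in> carrier G" "v \<in> base_verts"
  shows "left_mult G x (base_succ G k s v) = base_succ G k s (left_mult G x v)"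
  using assms s_closed k_pos by (auto simp: base_verts_def verts_D m_assoc)

text \<open>The choice-free form of the double cover, to which every outcome of the greedy
  construction is equal.\<close>

definition cover :: "'a vertex ugraph set" where
  "cover = inner_face_cycles G k s \<union> roof_edge_cycle G k s ` carrier G \<union>
     (\<Union>d\<in>{1..k}. base_edge_cycle G k s d ` carrier G)"

text \<open>By associativity translates of Cayley edges are Cayley edges, so a face goes to the face
  of the same shape at the translated edge or group element.\<close>

lemma left_mult_inner_face_cycles:
  assumes x: "x \<in> carrier G" and z: "z \<in> inner_face_cycles G k s"
  shows "map_graph (left_mult G x) z \<in> inner_face_cycles G k s"
proof -
  have "(d, x \<otimes> g, x \<otimes> h) \<in> cayley_edges G k s" if "(d, g, h) \<in> cayley_edges G k s" for d g h
    using that x s_closed by (auto simp: cayley_edges_def m_assoc)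
  note edge = this
  show ?thesis
    using z unfolding inner_face_cycles_def
  proof (elim UnE UN_E, goal_cases)
    case (1 e)
    then obtain d g h where "e = (d, g, h)" by (cases e)
    with 1 show ?case
      by (intro UnI1 UN_I[of "(d, x \<otimes> g, x \<otimes> h)"]) (auto simp: map_graph_cycle_graph edge)
  next
    case (2 g)
    then show ?case
      using x by (intro UnI2 UN_I[of "x \<otimes> g"])
        (auto simp: map_graph_cycle_graph o_def split: if_splits simp del: upt_Suc)
  qed
qed

lemma left_mult_cover:
  assumes x: "x \<in> carrier G" and z: "z \<in> cover"
  shows "map_graph (left_mult G x) z \<in> cover"
proof -
  have roof: "map_graph (left_mult G x) (roof_edge_cycle G k s g) = roof_edge_cycle G k s (x \<otimes> g)"
    if "g \<in> carrier G" for g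
  proof -
    have "A g 1 1 \<in> roof_verts" using that k_pos by (auto simp: roof_verts_def verts_D)
    then show ?thesis
      using roof.map_graph_orbit_graph[where h = "left_mult G x", OF left_mult_roof_succ[OF x]] x that
      by (simp add: roof_edge_cycle_eq)
  qed
  have "map_graph (left_mult G x) (base_edge_cycle G k s d g) = base_edge_cycle G k s d (x \<otimes> g)"
    if "g \<in> carrier G" "d \<in> {1..k}" for d g
  proof -
    have "A g d 2 \<in> base_verts" using that by (auto simp: base_verts_def verts_D)
    then show ?thesis
      using base.map_graph_orbit_graph[where h = "left_mult G x", OF left_mult_base_succ[OF x]] x that
      by (simp add: base_edge_cycle_eq)
  qed
  note base = this
  from z consider "z \<in> inner_face_cycles G k s"
    | g where "g \<in> carrier G" "z = roof_edge_cycle G k s g"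
    | d g where "d \<in> {1..k}" "g \<in> carrier G" "z = base_edge_cycle G k s d g"
    unfolding cover_def by blast
  then show ?thesis
  proof cases
    case 1
    then show ?thesis using left_mult_inner_face_cycles[OF x] by (simp add: cover_def)
  next
    case 2
    then show ?thesis using x roof[of g] by (simp add: cover_def)
  next
    case 3
    have "x \<otimes> g \<in> carrier G" using x 3 by simp
    then have "base_edge_cycle G k s d (x \<otimes> g) \<in> cover"
      using 3(1) unfolding cover_def by blast
    then show ?thesis using base[OF 3(2,1)] 3(3) by simp
  qed
qed

text \<open>Automorphisms and left multiplications are compared on \<open>verts D\<close> only, so
  the cycles must lie there before their images can be identified.\<close>

lemma cover_verts:
  assumes "z \<in> cover" shows "verts z \<subseteq> verts D"
proof -
  have "verts z \<subseteq> verts D" if "z \<in> inner_face_cycles G k s"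
    using that k_pos
    by (auto simp: inner_face_cycles_def verts_D cayley_edges_def s_closed split: if_splits)
  moreover have "verts z \<subseteq> verts D" if "z = roof_edge_cycle G k s g" "g \<in> carrier G" for g
  proof -
    have "A g 1 1 \<in> roof_verts" using that k_pos by (auto simp: roof_verts_def verts_D)
    then show ?thesis
      using roof.verts_orbit_graph_subset that by (auto simp: roof_edge_cycle_eq roof_verts_def)
  qed
  moreover have "verts z \<subseteq> verts D" if "z = base_edge_cycle G k s d g" "g \<in> carrier G" "d \<in> {1..k}" for g d
  proof -
    have "A g d 2 \<in> base_verts" using that by (auto simp: base_verts_def verts_D)
    then show ?thesis
      using base.verts_orbit_graph_subset that by (auto simp: base_edge_cycle_eq base_verts_def)
  qed
  ultimately show ?thesis
    using assms unfolding cover_def by blast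
qed

lemma cover_edges:
  assumes "z \<in> cover" shows "\<Union> (edges z) \<subseteq> verts z"
proof -
  have "inner_face_cycles G k s \<subseteq> range cycle_graph"
    by (auto simp: inner_face_cycles_def simp del: upt_Suc split: if_splits)
  then consider xs where "z = cycle_graph xs"
    | g where "g \<in> carrier G" "z = roof_edge_cycle G k s g"
    | d g where "1 \<le> d" "d \<le> k" "g \<in> carrier G" "z = base_edge_cycle G k s d g"
    using assms unfolding cover_def by auto
  then show ?thesis
    using edges_orbit_graph edges_cycle_graph
    by cases (simp_all only: roof_edge_cycle_eq base_edge_cycle_eq)
qed

end

section \<open>Neighbourhoods\<close>

text \<open>One description by colour for the three shapes of \<open>blow_up\<close>. For
  \<open>k = 2\<close> the edge between the \<open>C\<close> vertices is listed by both
  sectors.\<close>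

definition sector_edges :: "nat \<Rightarrow> 'g \<Rightarrow> nat \<Rightarrow> 'g vertex set set" where
  "sector_edges k g d = {{A g d 1, A g d 2}, {A g d 3, A g d 4}, {A g d 4, A g (nxt k d) 1}} \<union>
    (if k = 1 then {{A g d 2, A g d 3}} else {{A g d 2, C g d 1}, {C g d 1, A g d 3}}) \<union>
    (if k = 2 then {{C g d 1, C g (nxt k d) 1}} else {}) \<union>
    (if 3 \<le> k then {{C g d 1, C g d 2}, {C g d 2, C g (nxt k d) 2}} else {})"

lemma edges_blow_up:
  assumes "1 \<le> k"
  shows "edges (blow_up k g) = (\<Union>d\<in>{1..k}. sector_edges k g d)"
proof -
  consider "k = 1" | "k = 2" | "3 \<le> k"
    using assms by linarith
  then show ?thesis
  proof cases
    case 1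
    then show ?thesis
      by (simp add: blow_up_def sector_edges_def nxt_def insert_commute)
  next
    case 2
    have "{1..k} = {1, 2}" using 2 by auto
    moreover have "sector_edges k g 1 = {{A g 1 1, A g 1 2}, {A g 1 2, C g 1 1}, {C g 1 1, A g 1 3},
        {A g 1 3, A g 1 4}, {A g 1 4, A g (nxt k 1) 1}} \<union> {{C g 1 1, C g 2 1}}"
      using 2 by (simp add: sector_edges_def nxt_def insert_commute numeral_2_eq_2)
    moreover have "sector_edges k g 2 = {{A g 2 1, A g 2 2}, {A g 2 2, C g 2 1}, {C g 2 1, A g 2 3},
        {A g 2 3, A g 2 4}, {A g 2 4, A g (nxt k 2) 1}} \<union> {{C g 1 1, C g 2 1}}"
      using 2 by (simp add: sector_edges_def nxt_def insert_commute numeral_2_eq_2)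
    ultimately show ?thesis
      using 2 by (simp add: blow_up_def Un_ac)
  next
    case 3
    have "sector_edges k g d =
      {{A g d 1, A g d 2}, {A g d 2, C g d 1}, {C g d 1, A g d 3}, {A g d 3, A g d 4},
       {C g d 1, C g d 2}, {C g d 2, C g (nxt k d) 2}, {A g d 4, A g (nxt k d) 1}}" for d
      using 3 unfolding sector_edges_def
      by (simp, intro equalityI subsetI; elim UnE insertE emptyE; hypsubst;
          simp only: insert_iff Un_iff simp_thms)
    then show ?thesis
      using 3 by (simp add: blow_up_def)
  qed
qed

lemma sector_edges_iff:
  "e \<in> sector_edges k g d \<longleftrightarrow>
     e = {A g d 1, A g d 2} \<or> e = {A g d 3, A g d 4} \<or> e = {A g d 4, A g (nxt k d) 1} \<or>
     k = 1 \<and> e = {A g d 2, A g d 3} \<or> k \<noteq> 1 \<and> e = {A g d 2, C g d 1} \<or>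
     k \<noteq> 1 \<and> e = {C g d 1, A g d 3} \<or> k = 2 \<and> e = {C g d 1, C g (nxt k d) 1} \<or>
     3 \<le> k \<and> e = {C g d 1, C g d 2} \<or> 3 \<le> k \<and> e = {C g d 2, C g (nxt k d) 2}"
proof -
  consider "k = 1" | "k = 2" | "3 \<le> k" | "k = 0"
    by linarith
  then show ?thesis
    unfolding sector_edges_def Un_iff insert_iff by cases simp_all
qed

text \<open>Adjacency as an explicit set, so that case analysis can be done by simplification. At
  \<open>A g d 3\<close> and \<open>A g d 4\<close> the chain is the incoming one, which starts at
  \<open>g\<close> times the inverse of \<open>s d\<close>.\<close>

fun neighbours :: "('g, 'm) monoid_scheme \<Rightarrow> nat \<Rightarrow> (nat \<Rightarrow> 'g) \<Rightarrow> 'g vertex \<Rightarrow> 'g vertex set" where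
  "neighbours G k s (A g d i) =
     (if i = 1 then {X d g (g \<otimes>\<^bsub>G\<^esub> s d) (U 1), A g d 2, A g (prv k d) 4}
      else if i = 2 then {X d g (g \<otimes>\<^bsub>G\<^esub> s d) (L 1), A g d 1, if k = 1 then A g d 3 else C g d 1}
      else if i = 3 then {X d (g \<otimes>\<^bsub>G\<^esub> inv\<^bsub>G\<^esub> s d) g (N 9), A g d 4, if k = 1 then A g d 2 else C g d 1}
      else {X d (g \<otimes>\<^bsub>G\<^esub> inv\<^bsub>G\<^esub> s d) g (N 6), A g d 3, A g (nxt k d) 1})"
| "neighbours G k s (C g d i) =
     (if i = 1 then {A g d 2, A g d 3, if k = 2 then C g (nxt k d) 1 else C g d 2}
      else {C g d 1, C g (nxt k d) 2, C g (prv k d) 2})"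
| "neighbours G k s (X d g h (U i)) =
     {if i = 1 then A g d 1 else X d g h (U (i - 1)), X d g h (if i = d then N 4 else U (i + 1)),
      X d g h (L i)}"
| "neighbours G k s (X d g h (L i)) =
     {if i = 1 then A g d 2 else X d g h (L (i - 1)), X d g h (if i = d then N 7 else L (i + 1)),
      X d g h (U i)}"
| "neighbours G k s (X d g h (N i)) =
     (if i = 0 then X d g h ` {N 1, N 2, N 3}
      else if i = 1 then X d g h ` {N 0, N 3, N 6}
      else if i = 2 then X d g h ` {N 0, N 4, N 5}
      else if i = 3 then X d g h ` {N 0, N 1, N 5}
      else if i = 4 then X d g h ` {N 2, N 7, U d}
      else if i = 5 then X d g h ` {N 2, N 3, N 8}
      else if i = 6 then {X d g h (N 1), X d g h (N 9), A h d 4}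
      else if i = 7 then X d g h ` {N 4, N 8, L d}
      else if i = 8 then X d g h ` {N 5, N 7, N 9}
      else {X d g h (N 6), X d g h (N 8), A h d 3})"

lemma nxt_prv_neq [simp]:
  "2 \<le> k \<Longrightarrow> 1 \<le> d \<Longrightarrow> d \<le> k \<Longrightarrow> nxt k d \<noteq> d" "2 \<le> k \<Longrightarrow> 1 \<le> d \<Longrightarrow> d \<le> k \<Longrightarrow> d \<noteq> nxt k d"
  "2 \<le> k \<Longrightarrow> 1 \<le> d \<Longrightarrow> d \<le> k \<Longrightarrow> prv k d \<noteq> d" "2 \<le> k \<Longrightarrow> 1 \<le> d \<Longrightarrow> d \<le> k \<Longrightarrow> d \<noteq> prv k d"
  by (auto simp: nxt_def prv_def)

context cayley_cover
begin

abbreviation nbs :: "'a vertex \<Rightarrow> 'a vertex set" where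
  "nbs \<equiv> neighbours G k s"

lemma mult_inv_cancel [simp]:
  "g \<in> carrier G \<Longrightarrow> x \<in> carrier G \<Longrightarrow> g \<otimes> x \<otimes> inv x = g"
  "g \<in> carrier G \<Longrightarrow> x \<in> carrier G \<Longrightarrow> g \<otimes> inv x \<otimes> x = g"
  by (simp_all add: m_assoc)

lemma le_9_iff: "i \<le> 9 \<longleftrightarrow> i \<in> {0, 1, 2, 3, 4, 5, 6, 7, 8, 9::nat}"
  by auto

lemma chain_label_edge_imp_nbs:
  "{l, m} \<in> chain_label_edges d \<Longrightarrow> X d g h m \<in> nbs (X d g h l)"
  by (cases l; cases m) (auto simp: chain_label_edges_def doubleton_eq_iff)

lemma chain_label_edgesI:
  "1 \<le> i \<Longrightarrow> i < d \<Longrightarrow> {U i, U (i + 1)} \<in> chain_label_edges d"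
  "1 \<le> i \<Longrightarrow> i < d \<Longrightarrow> {L i, L (i + 1)} \<in> chain_label_edges d"
  "1 \<le> i \<Longrightarrow> i \<le> d \<Longrightarrow> {U i, L i} \<in> chain_label_edges d"
  "{U d, N 4} \<in> chain_label_edges d" "{L d, N 7} \<in> chain_label_edges d"
  "{N 0, N 1} \<in> chain_label_edges d" "{N 0, N 2} \<in> chain_label_edges d"
  "{N 0, N 3} \<in> chain_label_edges d" "{N 1, N 3} \<in> chain_label_edges d"
  "{N 1, N 6} \<in> chain_label_edges d" "{N 2, N 4} \<in> chain_label_edges d"
  "{N 2, N 5} \<in> chain_label_edges d" "{N 3, N 5} \<in> chain_label_edges d"
  "{N 4, N 7} \<in> chain_label_edges d" "{N 5, N 8} \<in> chain_label_edges d"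
  "{N 6, N 9} \<in> chain_label_edges d" "{N 7, N 8} \<in> chain_label_edges d"
  "{N 8, N 9} \<in> chain_label_edges d"
  unfolding chain_label_edges_def
    apply (rule UnI1, rule UnI1, rule UnI1, rule UnI1, intro CollectI exI[of _ i] conjI refl; assumption)
    apply (rule UnI1, rule UnI1, rule UnI1, rule UnI2, intro CollectI exI[of _ i] conjI refl; assumption)
    apply (rule UnI1, rule UnI1, rule UnI2, intro CollectI exI[of _ i] conjI refl; assumption)
    apply (rule UnI1, rule UnI2, simp)
    apply (rule UnI1, rule UnI2, simp)
    apply (rule UnI2, simp)+
    done

lemma chain_label_edge_doubleton: "e \<in> chain_label_edges d \<Longrightarrow> \<exists>l m. e = {l, m}"
  unfolding chain_label_edges_def by (elim UnE CollectE exE insertE conjE emptyE; blast)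

lemma edge_imp_nbs:
  assumes "{x, y} \<in> edges D" shows "y \<in> nbs x"
proof -
  \<comment> \<open>Edges are unordered pairs, so the claim is stated for both orientations at
    once.\<close>
  define P where "P e \<longleftrightarrow> (\<forall>x y. e = {x, y} \<longrightarrow> y \<in> nbs x)" for e
  have PI: "P {a, b}" if "b \<in> nbs a" "a \<in> nbs b" for a b
    using that by (auto simp: P_def doubleton_eq_iff)
  have chain: "P e" if e: "e \<in> edges (chain d g h)" for d g h e
  proof -
    obtain f where f: "f \<in> chain_label_edges d" "e = X d g h ` f"
      using e by (auto simp: chain_def map_graph_def)
    then obtain l m where "f = {l, m}"
      using chain_label_edge_doubleton by blast
    with f have lm: "e = {X d g h l, X d g h m}" "{l, m} \<in> chain_label_edges d"
      by simp_all
    then have "{m, l} \<in> chain_label_edges d" by (simp add: insert_commute)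
    with lm show ?thesis by (simp add: PI chain_label_edge_imp_nbs)
  qed
  have link: "P e" if "(d, g, h) \<in> cayley_edges G k s"
    "e \<in> {{A g d 1, X d g h (U 1)}, {A g d 2, X d g h (L 1)},
                  {X d g h (N 6), A h d 4}, {X d g h (N 9), A h d 3}}" for d g h e
    using that s_closed by (auto intro!: PI simp: cayley_edges_def)
  have blow: "P e" if blow_e: "e \<in> edges (blow_up k g)" for g e
  proof -
    obtain d where d: "1 \<le> d" "d \<le> k" and e: "e \<in> sector_edges k g d"
      using blow_e unfolding edges_blow_up[OF k_pos] by auto
    \<comment> \<open>With two colours this gives \<open>nxt k (nxt k d) = d\<close>, so the edge
      between the \<open>C\<close> vertices is seen from both ends.\<close>
    have k2: "nxt k d = prv k d" if "k = 2"
      using that d by (auto simp: nxt_def prv_def)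
    from e[unfolded sector_edges_iff] show ?thesis
    proof (elim disjE conjE, goal_cases)
      case 1
      have "A g d 2 \<in> nbs (A g d 1)" "A g d 1 \<in> nbs (A g d 2)"
        unfolding neighbours.simps using d by auto
      then show ?thesis unfolding 1 by (rule PI)
    next
      case 2
      have "A g d 4 \<in> nbs (A g d 3)" "A g d 3 \<in> nbs (A g d 4)"
        unfolding neighbours.simps using d by auto
      then show ?thesis unfolding 2 by (rule PI)
    next
      case 3
      have "A g (nxt k d) 1 \<in> nbs (A g d 4)" "A g d 4 \<in> nbs (A g (nxt k d) 1)"
        unfolding neighbours.simps using d by auto
      then show ?thesis unfolding 3 by (rule PI)
    next
      case 4
      have "A g d 3 \<in> nbs (A g d 2)" "A g d 2 \<in> nbs (A g d 3)"
        unfolding neighbours.simps using d 4(1) by auto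
      then show ?thesis unfolding 4(2) by (rule PI)
    next
      case 5
      have "C g d 1 \<in> nbs (A g d 2)" "A g d 2 \<in> nbs (C g d 1)"
        unfolding neighbours.simps using d 5(1) by auto
      then show ?thesis unfolding 5(2) by (rule PI)
    next
      case 6
      have "A g d 3 \<in> nbs (C g d 1)" "C g d 1 \<in> nbs (A g d 3)"
        unfolding neighbours.simps using d 6(1) by auto
      then show ?thesis unfolding 6(2) by (rule PI)
    next
      case 7
      have "C g (nxt k d) 1 \<in> nbs (C g d 1)" "C g d 1 \<in> nbs (C g (nxt k d) 1)"
        unfolding neighbours.simps using d 7(1) k2 by auto
      then show ?thesis unfolding 7(2) by (rule PI)
    next
      case 8
      have "C g d 2 \<in> nbs (C g d 1)" "C g d 1 \<in> nbs (C g d 2)"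
        unfolding neighbours.simps using d 8(1) by auto
      then show ?thesis unfolding 8(2) by (rule PI)
    next
      case 9
      have "C g (nxt k d) 2 \<in> nbs (C g d 2)" "C g d 2 \<in> nbs (C g (nxt k d) 2)"
        unfolding neighbours.simps using d 9(1) by auto
      then show ?thesis unfolding 9(2) by (rule PI)
    qed
  qed
  have "P {x, y}"
    using assms unfolding D_graph_def ugraph.simps
  proof (elim UnE UN_E)
    fix g assume "{x, y} \<in> edges (blow_up k g)"
    then show ?thesis by (rule blow)
  next
    fix e assume "{x, y} \<in> (case e of (d, g, h) \<Rightarrow> edges (chain d g h))"
    then show ?thesis by (cases e) (simp add: chain)
  next
    fix e assume e: "e \<in> cayley_edges G k s"
      "{x, y} \<in> (case e of (d, g, h) \<Rightarrow> {{A g d 1, X d g h (U 1)}, {A g d 2, X d g h (L 1)},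
                  {X d g h (N 6), A h d 4}, {X d g h (N 9), A h d 3}})"
    obtain d g h where dgh: "e = (d, g, h)" by (cases e)
    show ?thesis by (rule link[of d g h]) (use e in \<open>simp_all only: dgh prod.case\<close>)
  qed
  then show ?thesis by (auto simp: P_def)
qed

lemma nbs_imp_edge:
  assumes "x \<in> verts D" "y \<in> nbs x" shows "{x, y} \<in> edges D"
proof -
  have blow: "e \<in> edges D" if "g \<in> carrier G" "e \<in> edges (blow_up k g)" for g e
    using that unfolding D_graph_def by auto
  have chain: "{Y d g l, Y d g m} \<in> edges D"
    if "g \<in> carrier G" "1 \<le> d" "d \<le> k" "{l, m} \<in> chain_label_edges d" for d g l m
  proof -
    have "{Y d g l, Y d g m} \<in> edges (chain d g (g \<otimes> s d))"
      using imageI[OF that(4), of "(`) (Y d g)"] by (simp add: chain_def map_graph_def)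
    moreover have "(d, g, g \<otimes> s d) \<in> cayley_edges G k s"
      using that by (simp add: cayley_edges_def)
    ultimately show ?thesis
      unfolding D_graph_def ugraph.simps by (intro UnI1 UnI2 UN_I[of "(d, g, g \<otimes> s d)"]) auto
  qed
  have link: "{A g d 1, Y d g (U 1)} \<in> edges D" "{A g d 2, Y d g (L 1)} \<in> edges D"
    "{Y d g (N 6), A (g \<otimes> s d) d 4} \<in> edges D" "{Y d g (N 9), A (g \<otimes> s d) d 3} \<in> edges D"
    if "g \<in> carrier G" "1 \<le> d" "d \<le> k" for g d
  proof -
    have "(d, g, g \<otimes> s d) \<in> cayley_edges G k s"
      using that by (simp add: cayley_edges_def)
    then show "{A g d 1, Y d g (U 1)} \<in> edges D" "{A g d 2, Y d g (L 1)} \<in> edges D"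
      "{Y d g (N 6), A (g \<otimes> s d) d 4} \<in> edges D" "{Y d g (N 9), A (g \<otimes> s d) d 3} \<in> edges D"
      unfolding D_graph_def ugraph.simps by (intro UnI2 UN_I[of "(d, g, g \<otimes> s d)"]; simp)+
  qed
  have ring: "{A g d 1, A g d 2} \<in> edges D" "{A g d 3, A g d 4} \<in> edges D"
      "{A g d 4, A g (nxt k d) 1} \<in> edges D"
      "k = 1 \<Longrightarrow> {A g d 2, A g d 3} \<in> edges D"
      "k \<noteq> 1 \<Longrightarrow> {A g d 2, C g d 1} \<in> edges D" "k \<noteq> 1 \<Longrightarrow> {C g d 1, A g d 3} \<in> edges D"
      "k = 2 \<Longrightarrow> {C g d 1, C g (nxt k d) 1} \<in> edges D"
      "3 \<le> k \<Longrightarrow> {C g d 1, C g d 2} \<in> edges D" "3 \<le> k \<Longrightarrow> {C g d 2, C g (nxt k d) 2} \<in> edges D"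
    if "g \<in> carrier G" "1 \<le> d" "d \<le> k" for g d
  proof -
    have "sector_edges k g d \<subseteq> edges D"
    proof
      fix e assume "e \<in> sector_edges k g d"
      then show "e \<in> edges D"
        by (intro blow[OF that(1)]) (use that in \<open>auto simp: edges_blow_up[OF k_pos]\<close>)
    qed
    then show "{A g d 1, A g d 2} \<in> edges D" "{A g d 3, A g d 4} \<in> edges D"
      "{A g d 4, A g (nxt k d) 1} \<in> edges D"
      "k = 1 \<Longrightarrow> {A g d 2, A g d 3} \<in> edges D"
      "k \<noteq> 1 \<Longrightarrow> {A g d 2, C g d 1} \<in> edges D" "k \<noteq> 1 \<Longrightarrow> {C g d 1, A g d 3} \<in> edges D"
      "k = 2 \<Longrightarrow> {C g d 1, C g (nxt k d) 1} \<in> edges D"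
      "3 \<le> k \<Longrightarrow> {C g d 1, C g d 2} \<in> edges D" "3 \<le> k \<Longrightarrow> {C g d 2, C g (nxt k d) 2} \<in> edges D"
      unfolding sector_edges_def by simp_all
  qed
  have sym: "{u, v} \<in> edges D \<Longrightarrow> {v, u} \<in> edges D" for u v
    by (simp add: insert_commute)
  show ?thesis
  proof (cases x)
    case (A g d i)
    have g: "g \<in> carrier G" "1 \<le> d" "d \<le> k" "i \<in> {1, 2, 3, 4}" "g \<otimes> inv s d \<in> carrier G"
      using assms(1) k_pos s_closed unfolding A by (auto simp: verts_D)
    have p: "1 \<le> prv k d" "prv k d \<le> k" using g by auto
    \<comment> \<open>This edge belongs to the sector of the preceding colour.\<close>
    have up: "{A g (prv k d) 4, A g d 1} \<in> edges D"
      using ring(3)[OF g(1) p] g by simp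
    show ?thesis
      using assms(2) g link[OF g(1-3)] link[OF g(5,2,3), THEN sym] ring[OF g(1-3)]
        ring[OF g(1-3), THEN sym] up[THEN sym] s_closed
      unfolding A by (auto split: if_splits)
  next
    case (C g d i)
    have g: "g \<in> carrier G" "1 \<le> d" "d \<le> k" "i = 1 \<and> 2 \<le> k \<or> i = 2 \<and> 3 \<le> k"
      using assms(1) k_pos unfolding C by (auto simp: verts_D)
    have p: "1 \<le> prv k d" "prv k d \<le> k" using g by auto
    have down: "3 \<le> k \<Longrightarrow> {C g (prv k d) 2, C g d 2} \<in> edges D"
      using ring(9)[OF g(1) p] g by simp
    show ?thesis
      using assms(2) g ring[OF g(1-3)] ring[OF g(1-3), THEN sym] down[THEN sym]
      unfolding C by (auto split: if_splits)
  next
    case (X d g h l)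
    have g: "g \<in> carrier G" "1 \<le> d" "d \<le> k" "h = g \<otimes> s d" "l \<in> chain_labels d"
      using assms(1) unfolding X by (auto simp: verts_D)
    have x: "x = Y d g l" using X g by simp
    note edges = chain_label_edgesI(4-)[THEN chain[OF g(1-3)]] link[OF g(1-3)]
    note ladder = chain[OF g(1-3) chain_label_edgesI(1)] chain[OF g(1-3) chain_label_edgesI(2)]
      chain[OF g(1-3) chain_label_edgesI(3)] edges(1,2,16,17)
    show ?thesis
    proof (cases l)
      case (U i)
      then obtain j where "i = Suc j" using g by (cases i) auto
      then show ?thesis
        using assms(2) g U ladder ladder[THEN sym] unfolding x by (auto split: if_splits)
    next
      case (L i)
      then obtain j where "i = Suc j" using g by (cases i) auto
      then show ?thesis
        using assms(2) g L ladder ladder[THEN sym] unfolding x by (auto split: if_splits)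
    next
      case (N i)
      then have "i \<in> {0, 1, 2, 3, 4, 5, 6, 7, 8, 9}" using g le_9_iff by simp
      then show ?thesis
        using assms(2) unfolding x N
        by (elim insertE emptyE; hypsubst) (auto simp: edges[unfolded One_nat_def] edges[THEN sym, unfolded One_nat_def])
    qed
  qed
qed

lemma nbs_in_verts:
  assumes "x \<in> verts D" "y \<in> nbs x" shows "y \<in> verts D"
proof (cases x)
  case (A g d i)
  then show ?thesis
    using assms k_pos s_closed by (auto simp: verts_D split: if_splits)
next
  case (C g d i)
  then show ?thesis
    using assms k_pos by (auto simp: verts_D split: if_splits)
next
  case (X d g h l)
  then show ?thesis
    using assms k_pos s_closed by (cases l) (auto simp: verts_D split: if_splits)
qed

end

section \<open>Automorphisms\<close>

context cayley_cover
begin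

text \<open>The rungs of the ladder that starts at the edge between the labels 4 and 7 of a \<open>d\<close>-chain:
  the rungs \<open>1, \<dots>, d\<close> are the edges \<open>{u\<^sub>i, \<ell>\<^sub>i}\<close>, and rung \<open>d + 1\<close> lies in the blow-up graph.  The
  vertices with index \<open>d + 2\<close> are adjacent only if \<open>k = 1\<close>, so the ladder determines \<open>d\<close>.\<close>

definition upper :: "nat \<Rightarrow> 'a \<Rightarrow> nat \<Rightarrow> 'a vertex" where
  "upper d g j =
     (if j = 0 then Y d g (N 4) else if j \<le> d then Y d g (U (d + 1 - j))
      else if j = d + 1 then A g d 1 else A g (prv k d) 4)"

definition lower :: "nat \<Rightarrow> 'a \<Rightarrow> nat \<Rightarrow> 'a vertex" where
  "lower d g j =
     (if j = 0 then Y d g (N 7) else if j \<le> d then Y d g (L (d + 1 - j))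
      else if j = d + 1 then A g d 2 else if k = 1 then A g 1 3 else C g d 1)"

context
  fixes d g assumes d: "1 \<le> d" "d \<le> k" and g: "g \<in> carrier G"
begin

lemma ladder_verts: "j \<le> d + 2 \<Longrightarrow> upper d g j \<in> verts D" "j \<le> d + 2 \<Longrightarrow> lower d g j \<in> verts D"
  using d g k_pos by (auto simp: upper_def lower_def verts_D)

lemma nbs_ladder:
  assumes "j \<le> d"
  shows "nbs (upper d g (Suc j)) = {upper d g j, upper d g (Suc (Suc j)), lower d g (Suc j)}"
    and "nbs (lower d g (Suc j)) = {lower d g j, lower d g (Suc (Suc j)), upper d g (Suc j)}"
proof -
  \<comment> \<open>The shape changes at \<open>j = 0\<close>, next to the labels 4 and 7, and at
    \<open>j = d\<close>, where the ladder enters the blow-up graph.\<close>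
  consider "j = d" "j = 0" | j' where "j = d" "j = Suc j'" | "j = 0" "j < d" | "0 < j" "j < d"
    using assms by (cases j) (auto, linarith)
  then show "nbs (upper d g (Suc j)) = {upper d g j, upper d g (Suc (Suc j)), lower d g (Suc j)}"
    "nbs (lower d g (Suc j)) = {lower d g j, lower d g (Suc (Suc j)), upper d g (Suc j)}"
    by (cases; use d in \<open>auto simp: upper_def lower_def\<close>)+
qed

lemma ladder_distinct:
  "upper d g (Suc (Suc j)) \<noteq> upper d g j" "upper d g (Suc (Suc j)) \<noteq> lower d g (Suc j)"
  "lower d g (Suc (Suc j)) \<noteq> lower d g j" "lower d g (Suc (Suc j)) \<noteq> upper d g (Suc j)"
  if "j \<le> d"
  using d that by (auto simp: upper_def lower_def)

text \<open>Here the ladder breaks off: one rail continues into the sector of colour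
  \<open>prv k d\<close>, the other to the \<open>C\<close> vertex of colour
  \<open>d\<close>.\<close>

lemma ladder_end: "2 \<le> k \<Longrightarrow> lower d g (d + 2) \<notin> nbs (upper d g (d + 2))"
  using d by (auto simp: upper_def lower_def)

end

text \<open>The triangle \<open>0, 1, 3\<close> of a chain together with the adjacent quadrangle \<open>0, 2, 5, 3\<close>.\<close>

definition house :: "'a vertex \<Rightarrow> 'a vertex \<Rightarrow> 'a vertex \<Rightarrow> 'a vertex \<Rightarrow> 'a vertex \<Rightarrow> bool" where
  "house v0 v1 v2 v3 v5 \<longleftrightarrow> v1 \<in> verts D \<and> v0 \<in> nbs v1 \<and> v3 \<in> nbs v1 \<and> v3 \<in> nbs v0 \<and>
     v2 \<in> nbs v0 \<and> v5 \<in> nbs v3 \<and> v5 \<in> nbs v2 \<and> v2 \<noteq> v1 \<and> v2 \<noteq> v3 \<and> v5 \<noteq> v0 \<and> v5 \<noteq> v1"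

text \<open>Only vertices of triangles are candidates for \<open>v1\<close>. For
  \<open>k = 3\<close> the vertices \<open>C g d 2\<close> form triangles too, but the quadrangle
  excludes them; inside a chain it forces the common edge to join the labels 0 and 3. The second
  alternative is the reflection exchanging 0 with 3 and 2 with 5.\<close>

lemma house_cases:
  assumes "house v0 v1 v2 v3 v5"
  obtains d g where "1 \<le> d" "d \<le> k" "g \<in> carrier G"
    "v0 = Y d g (N 0)" "v1 = Y d g (N 1)" "v2 = Y d g (N 2)" "v3 = Y d g (N 3)" "v5 = Y d g (N 5)"
  | d g where "1 \<le> d" "d \<le> k" "g \<in> carrier G"
    "v0 = Y d g (N 3)" "v1 = Y d g (N 1)" "v2 = Y d g (N 5)" "v3 = Y d g (N 0)" "v5 = Y d g (N 2)"
proof -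
  have h: "v1 \<in> verts D" "v0 \<in> nbs v1" "v3 \<in> nbs v1" "v3 \<in> nbs v0" "v2 \<in> nbs v0" "v5 \<in> nbs v3"
    "v5 \<in> nbs v2" "v2 \<noteq> v1" "v2 \<noteq> v3" "v5 \<noteq> v0" "v5 \<noteq> v1"
    using assms by (auto simp: house_def)
  show ?thesis
  proof (cases v1)
    case (A g d i)
    have "False"
      using h(1-4) k_pos unfolding A
      by (auto simp: verts_D split: if_splits)
    then show ?thesis ..
  next
    case (C g d i)
    have g: "g \<in> carrier G" "1 \<le> d" "d \<le> k" "i = 1 \<and> 2 \<le> k \<or> i = 2 \<and> 3 \<le> k"
      using h(1) k_pos unfolding C by (auto simp: verts_D)
    have "False"
      using h(2-) g unfolding C
      by (auto split: if_splits)
    then show ?thesis ..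
  next
    case (X d g hh l)
    have g: "g \<in> carrier G" "1 \<le> d" "d \<le> k" "hh = g \<otimes> s d" "l \<in> chain_labels d"
      using h(1) unfolding X by (auto simp: verts_D)
    have x: "v1 = Y d g l" using X g by simp
    show ?thesis
    proof (cases l)
      case (U i)
      have False using h(2-4) g unfolding x U by (auto split: if_splits)
      then show ?thesis ..
    next
      case (L i)
      have False using h(2-4) g unfolding x L by (auto split: if_splits)
      then show ?thesis ..
    next
      case (N i)
      then have "i \<in> {0, 1, 2, 3, 4, 5, 6, 7, 8, 9}" using g le_9_iff by simp
      then have "i = 0 \<or> i = 1 \<or> i = 3" using h(2-4) g(2) unfolding x N
        by (elim insertE emptyE; hypsubst) (auto split: if_splits)
      then have "i = 1 \<and> (v0 = Y d g (N 0) \<and> v3 = Y d g (N 3) \<or> v0 = Y d g (N 3) \<and> v3 = Y d g (N 0))"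
        using h(2-) unfolding x N
        by (elim disjE; hypsubst) auto
      then show ?thesis
      proof (elim conjE disjE)
        assume *: "i = 1" "v0 = Y d g (N 0)" "v3 = Y d g (N 3)"
        have "v2 = Y d g (N 2)" "v5 = Y d g (N 5)"
          using h(5-) unfolding x N * by auto
        with that(1)[OF g(2,3,1)] * x N show ?thesis by simp
      next
        assume *: "i = 1" "v0 = Y d g (N 3)" "v3 = Y d g (N 0)"
        have "v2 = Y d g (N 5)" "v5 = Y d g (N 2)"
          using h(5-) unfolding x N * by auto
        with that(2)[OF g(2,3,1)] * x N show ?thesis by simp
      qed
    qed
  qed
qed

section \<open>Propagation of an automorphism along the graph\<close>

context
  fixes \<pi> assumes aut: "\<pi> \<in> graph_aut D"
begin

lemma aut_in_verts: "v \<in> verts D \<Longrightarrow> \<pi> v \<in> verts D"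
  using aut by (auto simp: graph_aut_def Bij_def bij_betw_def)

lemma aut_eq_iff: "u \<in> verts D \<Longrightarrow> v \<in> verts D \<Longrightarrow> \<pi> u = \<pi> v \<longleftrightarrow> u = v"
  using aut by (auto simp: graph_aut_def Bij_def bij_betw_def dest: inj_onD)

lemma aut_nbs_iff:
  assumes "u \<in> verts D" "v \<in> verts D"
  shows "\<pi> v \<in> nbs (\<pi> u) \<longleftrightarrow> v \<in> nbs u"
proof -
  have "{u, v} \<in> edges D \<longleftrightarrow> {\<pi> u, \<pi> v} \<in> edges D"
    using aut assms by (simp add: graph_aut_def)
  then show ?thesis
    using assms aut_in_verts edge_imp_nbs nbs_imp_edge by blast
qed

text \<open>In a cubic graph the images of two neighbours force that of the third, by injectivity.
  This carries the automorphism from vertex to vertex.\<close>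

lemma aut_third_neighbour:
  assumes "u \<in> verts D" "c \<in> nbs u" "a \<in> verts D" "b \<in> verts D" "c \<noteq> a" "c \<noteq> b"
    and "nbs (\<pi> u) \<subseteq> {\<pi> a, \<pi> b, c'}"
  shows "\<pi> c = c'"
proof -
  have c: "c \<in> verts D" using assms nbs_in_verts by blast
  then have "\<pi> c \<in> nbs (\<pi> u)" using assms by (simp add: aut_nbs_iff)
  moreover have "\<pi> c \<noteq> \<pi> a" "\<pi> c \<noteq> \<pi> b" using assms c by (simp_all add: aut_eq_iff)
  ultimately show ?thesis using assms(7) by auto
qed

lemma aut_house:
  assumes "house v0 v1 v2 v3 v5" shows "house (\<pi> v0) (\<pi> v1) (\<pi> v2) (\<pi> v3) (\<pi> v5)"
proof -
  have "v1 \<in> verts D" "v0 \<in> verts D" "v3 \<in> verts D" "v2 \<in> verts D" "v5 \<in> verts D"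
    using assms nbs_in_verts unfolding house_def by blast+
  with assms show ?thesis
    by (simp add: house_def aut_in_verts aut_nbs_iff aut_eq_iff)
qed

text \<open>The house settles five labels up to the reflection; the others follow one at a time from
  their neighbours. The colour \<open>d'\<close> of the image is not yet known to be
  \<open>d\<close>.\<close>

lemma aut_chain_core:
  assumes d: "1 \<le> d" "d \<le> k" and g: "g \<in> carrier G"
  obtains d' g' where "1 \<le> d'" "d' \<le> k" "g' \<in> carrier G"
    "\<And>i. i \<le> 9 \<Longrightarrow> \<pi> (Y d g (N i)) = Y d' g' (N i)"
    "\<pi> (Y d g (U d)) = Y d' g' (U d')" "\<pi> (Y d g (L d)) = Y d' g' (L d')"
proof -
  have v: "Y d g l \<in> verts D" if "l \<in> chain_labels d" for l
    using d g that by (simp add: verts_D)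
  have "house (Y d g (N 0)) (Y d g (N 1)) (Y d g (N 2)) (Y d g (N 3)) (Y d g (N 5))"
    using v by (simp add: house_def)
  from aut_house[OF this] show ?thesis
  proof (cases rule: house_cases)
    case (1 d' g')
    have 6: "\<pi> (Y d g (N 6)) = Y d' g' (N 6)"
      by (rule aut_third_neighbour[of "Y d g (N 1)" _ "Y d g (N 0)" "Y d g (N 3)"])
        (use 1 v in auto)
    have 4: "\<pi> (Y d g (N 4)) = Y d' g' (N 4)"
      by (rule aut_third_neighbour[of "Y d g (N 2)" _ "Y d g (N 0)" "Y d g (N 5)"])
        (use 1 v in auto)
    have 8: "\<pi> (Y d g (N 8)) = Y d' g' (N 8)"
      by (rule aut_third_neighbour[of "Y d g (N 5)" _ "Y d g (N 2)" "Y d g (N 3)"])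
        (use 1 v in auto)
    \<comment> \<open>The label 7 is the only common neighbour of the labels 4 and 8.\<close>
    have "\<pi> (Y d g (N 7)) \<in> nbs (Y d' g' (N 4))" "\<pi> (Y d g (N 7)) \<in> nbs (Y d' g' (N 8))"
      unfolding 4[symmetric] 8[symmetric] using v by (simp_all add: aut_nbs_iff)
    then have 7: "\<pi> (Y d g (N 7)) = Y d' g' (N 7)" by auto
    have 9: "\<pi> (Y d g (N 9)) = Y d' g' (N 9)"
      by (rule aut_third_neighbour[of "Y d g (N 8)" _ "Y d g (N 5)" "Y d g (N 7)"])
        (use 1 7 8 v in auto)
    have u: "\<pi> (Y d g (U d)) = Y d' g' (U d')"
      by (rule aut_third_neighbour[of "Y d g (N 4)" _ "Y d g (N 2)" "Y d g (N 7)"])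
        (use 1 4 7 v in auto)
    have l: "\<pi> (Y d g (L d)) = Y d' g' (L d')"
      by (rule aut_third_neighbour[of "Y d g (N 7)" _ "Y d g (N 4)" "Y d g (N 8)"])
        (use 1 4 7 8 v in auto)
    show ?thesis
      by (rule that[OF 1(1-3) _ u l]) (use 1 4 6 7 8 9 in \<open>auto simp: le_9_iff\<close>)
  next
    case (2 d' g')
    have 6: "\<pi> (Y d g (N 6)) = Y d' g' (N 6)"
      by (rule aut_third_neighbour[of "Y d g (N 1)" _ "Y d g (N 0)" "Y d g (N 3)"])
        (use 2 v in auto)
    have 4: "\<pi> (Y d g (N 4)) = Y d' g' (N 8)"
      by (rule aut_third_neighbour[of "Y d g (N 2)" _ "Y d g (N 0)" "Y d g (N 5)"])
        (use 2 v in auto)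
    have 8: "\<pi> (Y d g (N 8)) = Y d' g' (N 4)"
      by (rule aut_third_neighbour[of "Y d g (N 5)" _ "Y d g (N 2)" "Y d g (N 3)"])
        (use 2 v in auto)
    have "\<pi> (Y d g (N 7)) \<in> nbs (Y d' g' (N 8))" "\<pi> (Y d g (N 7)) \<in> nbs (Y d' g' (N 4))"
      unfolding 4[symmetric] 8[symmetric] using v by (simp_all add: aut_nbs_iff)
    then have 7: "\<pi> (Y d g (N 7)) = Y d' g' (N 7)" by auto
    \<comment> \<open>The reflection swaps 4 and 8, so it would send 9 into the ladder, to
      \<open>U d'\<close>, although 9 is adjacent to 6 and 6 keeps its label.\<close>
    have 9: "\<pi> (Y d g (N 9)) = Y d' g' (U d')"
      by (rule aut_third_neighbour[of "Y d g (N 8)" _ "Y d g (N 5)" "Y d g (N 7)"])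
        (use 2 7 8 v in auto)
    have "\<pi> (Y d g (N 9)) \<in> nbs (\<pi> (Y d g (N 6)))"
      using v by (simp add: aut_nbs_iff)
    then have False unfolding 6 9 by simp
    then show ?thesis ..
  qed
qed

text \<open>Two consecutive rungs are carried along because the third-neighbour argument needs the
  previous one. The bounds stop at the last rung whose neighbours are given by
  \<open>nbs_ladder\<close> in both ladders.\<close>

lemma aut_ladder:
  assumes d: "1 \<le> d" "d \<le> k" and g: "g \<in> carrier G"
    and d': "1 \<le> d'" "d' \<le> k" and g': "g' \<in> carrier G"
    and start: "\<pi> (upper d g 0) = upper d' g' 0" "\<pi> (lower d g 0) = lower d' g' 0"
      "\<pi> (upper d g 1) = upper d' g' 1" "\<pi> (lower d g 1) = lower d' g' 1"
    and "j \<le> d + 1" "j \<le> d' + 1"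
  shows "\<pi> (upper d g j) = upper d' g' j \<and> \<pi> (lower d g j) = lower d' g' j \<and>
    \<pi> (upper d g (Suc j)) = upper d' g' (Suc j) \<and> \<pi> (lower d g (Suc j)) = lower d' g' (Suc j)"
  using assms(11,12)
proof (induction j)
  case 0
  then show ?case using start by simp
next
  case (Suc j)
  then have j: "j \<le> d" "j \<le> d'" by auto
  have IH: "\<pi> (upper d g j) = upper d' g' j" "\<pi> (lower d g j) = lower d' g' j"
    "\<pi> (upper d g (Suc j)) = upper d' g' (Suc j)" "\<pi> (lower d g (Suc j)) = lower d' g' (Suc j)"
    using Suc by auto
  have v: "upper d g i \<in> verts D" "lower d g i \<in> verts D" if "i \<le> Suc (Suc j)" for i
    using ladder_verts[OF d g] j that by auto
  have "\<pi> (upper d g (Suc (Suc j))) = upper d' g' (Suc (Suc j))"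
    by (rule aut_third_neighbour[of "upper d g (Suc j)" _ "upper d g j" "lower d g (Suc j)"])
      (use v IH ladder_distinct[OF d g j(1)] in
        \<open>auto simp: nbs_ladder[OF d g j(1)] nbs_ladder[OF d' g' j(2)]\<close>)
  moreover have "\<pi> (lower d g (Suc (Suc j))) = lower d' g' (Suc (Suc j))"
    by (rule aut_third_neighbour[of "lower d g (Suc j)" _ "lower d g j" "upper d g (Suc j)"])
      (use v IH ladder_distinct[OF d g j(1)] in
        \<open>auto simp: nbs_ladder[OF d g j(1)] nbs_ladder[OF d' g' j(2)]\<close>)
  ultimately show ?case using IH by simp
qed

text \<open>The length of the ladder is preserved: if \<open>d\<close> and \<open>d'\<close>
  differed, the two vertices with index two beyond the smaller colour would be adjacent in one
  ladder and not in the other.\<close>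

lemma aut_chain:
  assumes d: "1 \<le> d" "d \<le> k" and g: "g \<in> carrier G"
  obtains g' where "g' \<in> carrier G" "\<And>i. i \<le> 9 \<Longrightarrow> \<pi> (Y d g (N i)) = Y d g' (N i)"
    "\<And>j. j \<le> d + 2 \<Longrightarrow> \<pi> (upper d g j) = upper d g' j"
    "\<And>j. j \<le> d + 2 \<Longrightarrow> \<pi> (lower d g j) = lower d g' j"
proof -
  obtain d' g' where d': "1 \<le> d'" "d' \<le> k" and g': "g' \<in> carrier G"
    and core: "\<And>i. i \<le> 9 \<Longrightarrow> \<pi> (Y d g (N i)) = Y d' g' (N i)"
      "\<pi> (Y d g (U d)) = Y d' g' (U d')" "\<pi> (Y d g (L d)) = Y d' g' (L d')"
    using aut_chain_core[OF d g] by blast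
  have ladder: "\<pi> (upper d g i) = upper d' g' i" "\<pi> (lower d g i) = lower d' g' i"
    if "i \<le> d + 2" "i \<le> d' + 2" for i
  proof -
    have "\<pi> (upper d g 0) = upper d' g' 0" "\<pi> (lower d g 0) = lower d' g' 0"
      "\<pi> (upper d g 1) = upper d' g' 1" "\<pi> (lower d g 1) = lower d' g' 1"
      using core d d' by (auto simp: upper_def lower_def)
    note step = aut_ladder[OF d g d' g' this]
    show "\<pi> (upper d g i) = upper d' g' i" "\<pi> (lower d g i) = lower d' g' i"
      using step[of "i - 1"] step[of 0] that by (cases i; simp)+
  qed
  have "d' = d"
  proof (cases "k = 1")
    case True
    then show ?thesis using d d' by simp
  next
    case False
    then have k: "2 \<le> k" using k_pos by simp
    show ?thesis
    proof (cases d d' rule: linorder_cases)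
      case less
      then have "lower d' g' (d + 2) \<in> nbs (upper d' g' (d + 2))"
        using nbs_ladder[OF d' g', of "d + 1"] by simp
      then have "\<pi> (lower d g (d + 2)) \<in> nbs (\<pi> (upper d g (d + 2)))"
        using ladder[of "d + 2"] less by simp
      then show ?thesis
        using aut_nbs_iff ladder_verts[OF d g, of "d + 2"] ladder_end[OF d g k] by simp
    next
      case greater
      then have "lower d g (d' + 2) \<in> nbs (upper d g (d' + 2))"
        using nbs_ladder[OF d g, of "d' + 1"] by simp
      then have "\<pi> (lower d g (d' + 2)) \<in> nbs (\<pi> (upper d g (d' + 2)))"
        using aut_nbs_iff ladder_verts[OF d g, of "d' + 2"] greater by simp
      then show ?thesis
        using ladder[of "d' + 2"] greater ladder_end[OF d' g' k] by simp
    qed simp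
  qed
  then show ?thesis
    using that[of g'] g' core(1) ladder by simp
qed

lemma aut_chain_ends:
  assumes d: "1 \<le> d" "d \<le> k" and g: "g \<in> carrier G"
  obtains g' where "g' \<in> carrier G" "\<And>l. l \<in> chain_labels d \<Longrightarrow> \<pi> (Y d g l) = Y d g' l"
    "\<pi> (A g d 1) = A g' d 1" "\<pi> (A g d 2) = A g' d 2" "\<pi> (A g (prv k d) 4) = A g' (prv k d) 4"
    "\<pi> (A (g \<otimes> s d) d 3) = A (g' \<otimes> s d) d 3" "\<pi> (A (g \<otimes> s d) d 4) = A (g' \<otimes> s d) d 4"
    "k = 1 \<Longrightarrow> \<pi> (A g 1 3) = A g' 1 3" "k \<noteq> 1 \<Longrightarrow> \<pi> (C g d 1) = C g' d 1"
proof -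
  obtain g' where g': "g' \<in> carrier G" and N: "\<And>i. i \<le> 9 \<Longrightarrow> \<pi> (Y d g (N i)) = Y d g' (N i)"
    and up: "\<And>j. j \<le> d + 2 \<Longrightarrow> \<pi> (upper d g j) = upper d g' j"
    and lo: "\<And>j. j \<le> d + 2 \<Longrightarrow> \<pi> (lower d g j) = lower d g' j"
    using aut_chain[OF d g] by blast
  have v: "Y d g l \<in> verts D" if "l \<in> chain_labels d" for l
    using d g that by (simp add: verts_D)
  have chain: "\<pi> (Y d g l) = Y d g' l" if "l \<in> chain_labels d" for l
  proof (cases l)
    case (U i)
    \<comment> \<open>Rungs are counted from the labels 4 and 7, so \<open>U i\<close> lies on rung
      \<open>d + 1 - i\<close>.\<close>
    then have i: "d + 1 - i \<le> d + 2" "d + 1 - (d + 1 - i) = i" "0 < d + 1 - i" "d + 1 - i \<le> d" "1 \<le> i"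
      using that by auto
    then show ?thesis using up[OF i(1)] U by (simp add: upper_def)
  next
    case (L i)
    then have i: "d + 1 - i \<le> d + 2" "d + 1 - (d + 1 - i) = i" "0 < d + 1 - i" "d + 1 - i \<le> d" "1 \<le> i"
      using that by auto
    then show ?thesis using lo[OF i(1)] L by (simp add: lower_def)
  next
    case (N i)
    then show ?thesis using that \<open>\<And>i. i \<le> 9 \<Longrightarrow> \<pi> (Y d g (N i)) = Y d g' (N i)\<close> by simp
  qed
  have top: "\<pi> (A (g \<otimes> s d) d 4) = A (g' \<otimes> s d) d 4"
    by (rule aut_third_neighbour[of "Y d g (N 6)" _ "Y d g (N 1)" "Y d g (N 9)"])
      (use v N in auto)
  have bottom: "\<pi> (A (g \<otimes> s d) d 3) = A (g' \<otimes> s d) d 3"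
    by (rule aut_third_neighbour[of "Y d g (N 9)" _ "Y d g (N 6)" "Y d g (N 8)"])
      (use v N in auto)
  show ?thesis
    by (rule that[OF g' chain _ _ _ bottom top])
      (use up[of "d + 1", unfolded upper_def] up[of "d + 2", unfolded upper_def]
        lo[of "d + 1", unfolded lower_def] lo[of "d + 2", unfolded lower_def] in simp_all)
qed

lemma aut_is_left_mult: "\<exists>x\<in>carrier G. \<forall>v\<in>verts D. \<pi> v = left_mult G x v"
proof -
  define good where "good d g g' \<longleftrightarrow> g' \<in> carrier G \<and>
    (\<forall>l\<in>chain_labels d. \<pi> (Y d g l) = Y d g' l) \<and>
    \<pi> (A g d 1) = A g' d 1 \<and> \<pi> (A g d 2) = A g' d 2 \<and> \<pi> (A g (prv k d) 4) = A g' (prv k d) 4 \<and>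
    \<pi> (A (g \<otimes> s d) d 3) = A (g' \<otimes> s d) d 3 \<and> \<pi> (A (g \<otimes> s d) d 4) = A (g' \<otimes> s d) d 4 \<and>
    (k = 1 \<longrightarrow> \<pi> (A g 1 3) = A g' 1 3) \<and> (k \<noteq> 1 \<longrightarrow> \<pi> (C g d 1) = C g' d 1)" for d g g'
  \<comment> \<open>\<open>\<phi> d g\<close> is the start of the chain onto which
    \<open>\<pi>\<close> maps the \<open>d\<close>-chain starting in \<open>g\<close>.\<close>
  define \<phi> where "\<phi> d g = (SOME g'. good d g g')" for d g
  have good: "good d g (\<phi> d g)" if "1 \<le> d" "d \<le> k" "g \<in> carrier G" for d g
  proof -
    have "\<exists>g'. good d g g'"
      using aut_chain_ends[OF that] unfolding good_def by metis
    then show ?thesis unfolding \<phi>_def by (rule someI_ex)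
  qed
  have closed: "\<phi> d g \<in> carrier G" if "1 \<le> d" "d \<le> k" "g \<in> carrier G" for d g
    using good[OF that] by (simp add: good_def)
  \<comment> \<open>Both chains determine the image of \<open>A (g \<otimes> s d) d 4\<close>: it is
    attached to the end of the first and ends the upper rail of the second.\<close>
  have nxt: "\<phi> (nxt k d) (g \<otimes> s d) = \<phi> d g \<otimes> s d" if "1 \<le> d" "d \<le> k" "g \<in> carrier G" for d g
    using good[OF that] good[of "nxt k d" "g \<otimes> s d"] that s_closed by (simp add: good_def)
  \<comment> \<open>The incoming and the outgoing \<open>d\<close>-chain at
    \<open>g \<otimes> s d\<close> share the vertex \<open>A (g \<otimes> s d) 1 3\<close> if
    \<open>k = 1\<close>; otherwise they are linked by its edge to
    \<open>C (g \<otimes> s d) d 1\<close>, and adjacent images lie in one blow-up graph.\<close>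
  have same: "\<phi> d (g \<otimes> s d) = \<phi> d g \<otimes> s d" if d: "1 \<le> d" "d \<le> k" and g: "g \<in> carrier G" for d g
  proof -
    have gs: "g \<otimes> s d \<in> carrier G" using g d s_closed by simp
    note good = good[OF d g] good[OF d gs]
    show ?thesis
    proof (cases "k = 1")
      case True
      then have "d = 1" using d by simp
      then show ?thesis using True good by (simp add: good_def)
    next
      case False
      have "C (g \<otimes> s d) d 1 \<in> verts D" "A (g \<otimes> s d) d 3 \<in> verts D"
        using d gs k_pos False by (auto simp: verts_D)
      then have "\<pi> (A (g \<otimes> s d) d 3) \<in> nbs (\<pi> (C (g \<otimes> s d) d 1))"
        by (subst aut_nbs_iff) auto
      then show ?thesis using False good by (auto simp: good_def split: if_splits)
    qed
  qed
  \<comment> \<open>Every group element ends some edge of colour \<open>d\<close>, so the two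
    preceding facts can be compared there.\<close>
  have step: "\<phi> (nxt k d) g = \<phi> d g" if "1 \<le> d" "d \<le> k" "g \<in> carrier G" for d g
    using nxt[of d "g \<otimes> inv s d"] same[of d "g \<otimes> inv s d"] that s_closed by simp
  have const: "\<phi> d g = \<phi> 1 g" if "1 \<le> d" "d \<le> k" "g \<in> carrier G" for d g
    using that(1,2)
  proof (induction d rule: dec_induct)
    case (step d)
    then show ?case using \<open>\<And>d g. 1 \<le> d \<Longrightarrow> d \<le> k \<Longrightarrow> g \<in> carrier G \<Longrightarrow> \<phi> (nxt k d) g = \<phi> d g\<close>[of d g] that(3)
      by (simp add: nxt_def)
  qed simp
  let ?x = "\<phi> 1 \<one>"
  have x: "?x \<in> carrier G" using closed k_pos by simp
  have closed1: "\<phi> 1 g \<in> carrier G" if "g \<in> carrier G" for g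
    using closed k_pos that by simp
  \<comment> \<open>All \<open>g\<close> are treated at once since a product
    \<open>h1 \<otimes> h2\<close> requires the claim for \<open>h2\<close> at
    \<open>g \<otimes> h1\<close>.\<close>
  have "\<forall>g\<in>carrier G. \<phi> 1 (g \<otimes> h) = \<phi> 1 g \<otimes> h" if "h \<in> generate G (s ` {1..k})" for h
    using that
  proof (induction rule: generate.induct)
    case one
    then show ?case using closed1 by simp
  next
    case (incl h)
    then obtain d where d: "1 \<le> d" "d \<le> k" "h = s d" by auto
    show ?case
    proof
      fix g assume g: "g \<in> carrier G"
      have "g \<otimes> h \<in> carrier G" using d g s_closed by simp
      then show "\<phi> 1 (g \<otimes> h) = \<phi> 1 g \<otimes> h"
        using same[OF d(1,2) g] const[OF d(1,2)] d(3) g by simp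
    qed
  next
    case (inv h)
    then obtain d where d: "1 \<le> d" "d \<le> k" "h = s d" by auto
    have h: "h \<in> carrier G" using d s_closed by simp
    show ?case
    proof
      fix g assume g: "g \<in> carrier G"
      have "\<phi> 1 g = \<phi> 1 (g \<otimes> inv h) \<otimes> h"
        using same[of d "g \<otimes> inv h"] const[of d] d g h by simp
      then show "\<phi> 1 (g \<otimes> inv h) = \<phi> 1 g \<otimes> inv h"
        using g h closed1 by simp
    qed
  next
    case (eng h1 h2)
    then have "h1 \<in> carrier G" "h2 \<in> carrier G" using generates by auto
    then show ?case using eng closed1 by (simp add: m_assoc[symmetric])
  qed
  \<comment> \<open>Taking \<open>\<one>\<close> as the left factor identifies
    \<open>\<phi> 1\<close> with the left multiplication by its value at
    \<open>\<one>\<close>.\<close>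
  then have \<phi>: "\<phi> d g = ?x \<otimes> g" if "1 \<le> d" "d \<le> k" "g \<in> carrier G" for d g
    using that const generates by (metis l_one one_closed)
  have "\<pi> v = left_mult G ?x v" if v: "v \<in> verts D" for v
  proof (cases v)
    case (A g d i)
    then have g: "g \<in> carrier G" "1 \<le> d" "d \<le> k" "i \<in> {1, 2, 3, 4}"
      using v k_pos by (auto simp: verts_D)
    \<comment> \<open>The indices 3 and 4 are governed by the incoming chain, which starts at
      \<open>g \<otimes> inv s d\<close>.\<close>
    have h: "g \<otimes> inv s d \<in> carrier G" "g \<otimes> inv s d \<otimes> s d = g"
      using g s_closed by simp_all
    have "?x \<otimes> (g \<otimes> inv s d) \<otimes> s d = ?x \<otimes> g"
      using g h x s_closed by (simp add: m_assoc)
    then show ?thesis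
      using good[OF g(2,3,1)] good[OF g(2,3) h(1)] \<phi>[OF g(2,3,1)] \<phi>[OF g(2,3) h(1)] h(2) g(4)
      unfolding A good_def by auto
  next
    case (C g d i)
    then have g: "g \<in> carrier G" "1 \<le> d" "d \<le> k" "i = 1 \<and> 2 \<le> k \<or> i = 2 \<and> 3 \<le> k"
      using v k_pos by (auto simp: verts_D)
    then have k1: "k \<noteq> 1" by auto
    have c1: "\<pi> (C g d 1) = C (?x \<otimes> g) d 1"
      using good[OF g(2,3,1)] \<phi>[OF g(2,3,1)] k1 by (simp add: good_def)
    have a2: "\<pi> (A g d 2) = A (?x \<otimes> g) d 2"
      using good[OF g(2,3,1)] \<phi>[OF g(2,3,1)] by (simp add: good_def)
    have h: "g \<otimes> inv s d \<in> carrier G" "g \<otimes> inv s d \<otimes> s d = g"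
      using g s_closed by simp_all
    have "?x \<otimes> (g \<otimes> inv s d) \<otimes> s d = ?x \<otimes> g"
      using g h x s_closed by (simp add: m_assoc)
    then have a3: "\<pi> (A g d 3) = A (?x \<otimes> g) d 3"
      using good[OF g(2,3) h(1)] \<phi>[OF g(2,3) h(1)] h(2) by (simp add: good_def)
    \<comment> \<open>No chain or ladder reaches this vertex; it is the third neighbour of
      \<open>C g d 1\<close>, whose other neighbours are settled by the outgoing and the incoming
      chain.\<close>
    have "\<pi> (C g d 2) = C (?x \<otimes> g) d 2" if "3 \<le> k"
      by (rule aut_third_neighbour[of "C g d 1" _ "A g d 2" "A g d 3"])
        (use that g k_pos c1 a2 a3 in \<open>auto simp: verts_D\<close>)
    then show ?thesis using C g(4) c1 by auto
  next
    case (X d g h l)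
    then have g: "g \<in> carrier G" "1 \<le> d" "d \<le> k" "h = g \<otimes> s d" "l \<in> chain_labels d"
      using v by (auto simp: verts_D)
    then show ?thesis
      using good[OF g(2,3,1)] \<phi>[OF g(2,3,1)] x s_closed X by (simp add: good_def m_assoc)
  qed
  with x show ?thesis by blast
qed

end

section \<open>Translates of the cover\<close>

lemma translates_aut_cover: "translates (aut_group D) (\<lambda>\<pi>. \<pi>) cover = cover"
proof (intro equalityI subsetI)
  fix z assume "z \<in> translates (aut_group D) (\<lambda>\<pi>. \<pi>) cover"
  then obtain \<pi> z' where \<pi>: "\<pi> \<in> graph_aut D" and z': "z' \<in> cover" "z = map_graph \<pi> z'"
    by (auto simp: translates_def aut_group_def)
  obtain x where "x \<in> carrier G" "\<forall>v\<in>verts D. \<pi> v = left_mult G x v"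
    using aut_is_left_mult[OF \<pi>] by blast
  moreover from this have "map_graph \<pi> z' = map_graph (left_mult G x) z'"
    using cover_verts[OF z'(1)] cover_edges[OF z'(1)] by (intro map_graph_cong) auto
  ultimately show "z \<in> cover" using left_mult_cover z' by simp
next
  fix z assume z: "z \<in> cover"
  \<comment> \<open>The identity gives the other inclusion; it is restricted because members of
    \<open>Bij\<close> are extensional.\<close>
  let ?id = "restrict id (verts D)"
  have "?id \<in> graph_aut D"
    by (auto simp: graph_aut_def Bij_def bij_betw_def inj_on_def)
  moreover have "map_graph ?id z = z"
    using cover_verts[OF z] cover_edges[OF z] by (intro map_graph_id) auto
  ultimately show "z \<in> translates (aut_group D) (\<lambda>\<pi>. \<pi>) cover"
    using z unfolding translates_def aut_group_def by force
qed

lemma left_mult_one: "v \<in> verts D \<Longrightarrow> left_mult G \<one> v = v"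
  using k_pos s_closed by (cases v) (auto simp: verts_D)

lemma translates_D_action_cover: "translates G (D_action G k s) cover = cover"
proof -
  have act: "map_graph (D_action G k s x) z = map_graph (left_mult G x) z" if "z \<in> cover" for x z
    using cover_verts[OF that] cover_edges[OF that]
    by (intro map_graph_cong) (auto simp: D_action_def)
  have "map_graph (left_mult G \<one>) z = z" if "z \<in> cover" for z
    using cover_verts[OF that] cover_edges[OF that]
    by (intro map_graph_id) (auto simp: left_mult_one)
  with act have id: "map_graph (D_action G k s \<one>) z = z" if "z \<in> cover" for z
    using that by simp
  show ?thesis
  proof (intro equalityI subsetI)
    fix z assume "z \<in> translates G (D_action G k s) cover"
    then show "z \<in> cover" by (auto simp: translates_def act left_mult_cover)
  next
    fix z assume "z \<in> cover"
    with id[OF this] show "z \<in> translates G (D_action G k s) cover"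
      unfolding translates_def by (intro CollectI exI[of _ \<one>] exI[of _ z]) simp
  qed
qed

end

theorem theorem5p4:
  fixes G :: "('g, 'm) monoid_scheme" and k :: nat and s :: "nat \<Rightarrow> 'g"
    and Z Zr Zb :: "'g vertex ugraph set"
  assumes "group G" and "finite (carrier G)"
    and "k \<ge> 1"
    and "inj_on s {1..k}" and "s ` {1..k} \<subseteq> carrier G"
    and "generate G (s ` {1..k}) = carrier G"
    and "roof_edge_cycles G k s Zr" and "base_edge_cycles G k s Zb"
    and "Z = inner_face_cycles G k s \<union> Zr \<union> Zb"
  shows "translates G (D_action G k s) Z = translates (aut_group (D_graph G k s)) (\<lambda>\<pi>. \<pi>) Z
       \<and> translates (aut_group (D_graph G k s)) (\<lambda>\<pi>. \<pi>) Z = Z"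
proof -
  interpret cayley_cover G k s
    using assms by (simp add: cayley_cover_def cayley_cover_axioms_def)
  \<comment> \<open>All outcomes of the greedy construction agree, so \<open>Z\<close> is the
    choice-free cover.\<close>
  have "Z = cover"
    using assms roof_edge_cycles_eq base_edge_cycles_eq by (simp add: cover_def)
  then show ?thesis
    using translates_aut_cover translates_D_action_cover by simp
qed

end
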